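(* Let $K\ge2$ and consider a $K$-armed stochastic bandit in which each arm distribution $\nu_a$ is a finitely supported probability distribution on $[0,1]$. Assume $\mu_a>0$ for all arms $a$ and $\mu^\star<1$. Run the empirical \texttt{KL-UCB} algorithm (described in the context) with $f(t)=\log(t)+\log(\log(t))$ for $t\ge2$. Then for every suboptimal arm $a$ (i.e. $\mu_a<\mu^\star$) there exists a constant $M(\nu_a,\mu^\star)>0$ depending only on $\nu_a$ and $\mu^\star$ such that, for all $T\ge3$, \[ \mathbb{E}[N_a(T)]\le \frac{\log(T)}{\mathcal{K}_{\inf}(\nu_a,\mu^\star)}+\frac{36}{(\mu^\star)^4}(\log T)^{4/5}\log(\log T)+\Big(\frac{72}{(\mu^\star)^4}+\frac{2\mu^\star}{(1-\mu^\star)\mathcal{K}_{\inf}(\nu_a,\mu^\star)^2}\Big)(\log T)^{4/5}+\frac{(1-\mu^\star)^2M(\nu_a,\mu^\star)}{2(\mu^\star)^2}(\log T)^{2/5}+\frac{\log(\log T)}{\mathcal{K}_{\inf}(\nu_a,\mu^\star)}+\frac{2\mu^\star}{(1-\mu^\star)\mathcal{K}_{\inf}(\nu_a,\mu^\star)^2}+4. \]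
   Context: Let $\mathcal{F}$ be the set of finitely supported probability distributions on $[0,1]$; $\mathrm{Supp}(\nu)$ is the finite support of $\nu\in\mathcal{F}$, $\mathbb{E}(\nu)$ its mean, $\mathrm{KL}$ the Kullback–Leibler divergence, and $\mathfrak{M}_1(S)$ the set of probability distributions on a set $S$. For $\nu\in\mathcal{F}$ and $\mu\in\mathbb{R}$, $\mathcal{K}_{\inf}(\nu,\mu)=\inf\{\mathrm{KL}(\nu,\nu'):\nu'\in\mathcal{F},\ \mathbb{E}(\nu')>\mu\}$. Bandit protocol: at each round $t\ge1$ the player picks an arm $A_t$ based on past information and receives a reward $Y_t$ drawn independently from $\nu_{A_t}$. $\mu_a=\mathbb{E}(\nu_a)$, $\mu^\star=\max_a\mu_a$, $N_a(t)=\sum_{s=1}^t\mathbf{1}\{A_s=a\}$, and $\hat\nu_a(t)=\frac{1}{N_a(t)}\sum_{s=1}^t\delta_{Y_s}\mathbf{1}\{A_s=a\}$ is the empirical distribution of arm $a$. Empirical \texttt{KL-UCB} algorithm with nondecreasing $f$: pull each arm once in rounds $1,\dots,K$; for $t=K,\dots,T-1$ compute for each arm $U_a(t)=\sup\{\mathbb{E}(\nu):\nu\in\mathfrak{M}_1(\mathrm{Supp}(\hat\nu_a(t))\cup\{1\}),\ \mathrm{KL}(\hat\nu_a(t),\nu)\le f(t)/N_a(t)\}$ and pull an arm $A_{t+1}\in\arg\max_aU_a(t)$. *)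

theory Defs
  imports "HOL-Probability.Probability"
begin

definition finsupp01 :: "real pmf \<Rightarrow> bool" where
  "finsupp01 p \<longleftrightarrow> finite (set_pmf p) \<and> set_pmf p \<subseteq> {0..1}"

definition mean :: "real pmf \<Rightarrow> real" where
  "mean p = measure_pmf.expectation p (\<lambda>x. x)"

definition KL :: "real pmf \<Rightarrow> real pmf \<Rightarrow> ereal" where
  "KL p q = (if set_pmf p \<subseteq> set_pmf q
     then ereal (\<Sum>x\<in>set_pmf p. pmf p x * ln (pmf p x / pmf q x))
     else \<infinity>)"

definition Kinf :: "real pmf \<Rightarrow> real \<Rightarrow> ereal" where
  "Kinf p \<mu> = Inf {KL p q | q. finsupp01 q \<and> mean q > \<mu>}"

definition fexp :: "nat \<Rightarrow> real" where
  "fexp t = ln (real t) + ln (ln (real t))"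

text \<open>Histories: list of (arm, reward) pairs, one per round so far.\<close>
type_synonym history = "(nat \<times> real) list"

definition Npulls :: "history \<Rightarrow> nat \<Rightarrow> nat" where
  "Npulls h b = length (filter (\<lambda>p. fst p = b) h)"

definition emp :: "history \<Rightarrow> nat \<Rightarrow> real pmf" where
  "emp h b = pmf_of_multiset (mset (map snd (filter (\<lambda>p. fst p = b) h)))"

definition ucb :: "history \<Rightarrow> nat \<Rightarrow> real" where
  "ucb h b = Sup {mean q | q. set_pmf q \<subseteq> set_pmf (emp h b) \<union> {1} \<and>
                 KL (emp h b) q \<le> ereal (fexp (length h) / real (Npulls h b))}"

text \<open>A (deterministic) policy implementing empirical KL-UCB with arms 0..K-1,
  with an arbitrary tie-breaking rule.\<close>
definition klucb_policy :: "nat \<Rightarrow> (history \<Rightarrow> nat) \<Rightarrow> bool" where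
  "klucb_policy K pol \<longleftrightarrow>
     (\<forall>h. length h < K \<longrightarrow> pol h = length h) \<and>
     (\<forall>h. length h \<ge> K \<longrightarrow> pol h < K \<and> (\<forall>b<K. ucb h b \<le> ucb h (pol h)))"

fun hist :: "(history \<Rightarrow> nat) \<Rightarrow> (nat \<Rightarrow> real pmf) \<Rightarrow> nat \<Rightarrow> history pmf" where
  "hist pol nu 0 = return_pmf []"
| "hist pol nu (Suc t) =
     bind_pmf (hist pol nu t) (\<lambda>h. map_pmf (\<lambda>y. h @ [(pol h, y)]) (nu (pol h)))"

end

theory Submission
  imports Defs "HOL-Real_Asymp.Real_Asymp"
begin

text \<open>Write \<open>\<epsilon> = (ln T) powr (-1/5)\<close> and \<open>m = \<mu>s (1 - \<epsilon>)\<close>. Whenever the suboptimal arm \<open>a\<close> is pulled,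
  either the index of an optimal arm is below \<open>m\<close> or the index of \<open>a\<close> is at least \<open>m\<close>. Both events
  are handled by the dual formula for \<open>Kinf\<close>, i.e. by the empirical log-likelihood ratios
  \<open>\<Sum> ln (tilt m l x)\<close> with \<open>0 \<le> l \<le> 1\<close>.

  In the first event some \<open>l\<close> makes the ratio of the optimal arm exceed \<open>fexp t\<close>. The supremum over \<open>l\<close>
  is replaced by a mixture of likelihood ratios at the price of a factor \<open>n + 1\<close>, and the gap between
  \<open>m\<close> and \<open>\<mu>s\<close> gives an additional factor \<open>(1 - \<rho>) ^ n\<close> with \<open>\<rho> = (\<mu>s \<epsilon>)\<^sup>2 / 4\<close>. Summing over \<open>n\<close> yields
  \<open>1 / \<rho>\<^sup>2 = 16 / (\<mu>s \<epsilon>) ^ 4\<close>, and summing \<open>exp (- fexp t) = 1 / (t ln t)\<close> yields \<open>ln (ln T) + 2\<close>.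

  In the second event the ratio of \<open>a\<close> at the dual parameter \<open>l\<close> that is optimal for \<open>\<mu>s\<close> is at most
  \<open>fexp T\<close>. Its drift is at least \<open>\<kappa> - c \<epsilon>\<close> with \<open>\<kappa> = Kinf \<nu> \<mu>s\<close> and \<open>c = \<mu>s / (1 - \<mu>s)\<close>, so beyond
  \<open>fexp T / (\<kappa> - 3/2 c \<epsilon>)\<close> pulls this has geometrically small probability; the geometric sum is
  \<open>O(1 / \<epsilon>\<^sup>2)\<close> and is absorbed, like all small \<open>T\<close>, by the constant \<open>M\<close>.\<close>

section \<open>Duality for the minimal divergence\<close>

lemma finite_pmf_exists:
  assumes "finite S" and "\<And>x. x \<in> S \<Longrightarrow> 0 \<le> w x" and "sum w S = (1::real)"
  shows "\<exists>q. set_pmf q \<subseteq> S \<and> (\<forall>x\<in>S. pmf q x = w x)"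
proof -
  let ?w = "\<lambda>x. if x \<in> S then w x else 0"
  have "(\<integral>\<^sup>+x. ennreal (?w x) \<partial>count_space UNIV) = (\<Sum>x\<in>S. ennreal (?w x))"
    using assms(1) by (intro nn_integral_count_space') auto
  also have "\<dots> = ennreal (sum w S)"
    using assms(2) by (subst sum_ennreal) (auto intro: sum.cong)
  finally have 1: "(\<integral>\<^sup>+x. ennreal (?w x) \<partial>count_space UNIV) = 1"
    using assms(3) by simp
  have "pmf (embed_pmf ?w) x = ?w x" for x
    using assms(2) 1 by (intro pmf_embed_pmf) auto
  then have "set_pmf (embed_pmf ?w) \<subseteq> S \<and> (\<forall>x\<in>S. pmf (embed_pmf ?w) x = w x)"
    by (auto simp: set_pmf_iff split: if_splits)
  then show ?thesis by blast
qed

text \<open>\<open>tilt \<mu> l\<close> is the linear density \<open>1 - l (x - \<mu>) / (1 - \<mu>)\<close>, equal to \<open>1\<close> at \<open>\<mu>\<close> and \<open>1 - l\<close> at \<open>1\<close>.\<close>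

definition tilt :: "real \<Rightarrow> real \<Rightarrow> real \<Rightarrow> real" where
  "tilt \<mu> l x = 1 - l + l * ((1 - x) / (1 - \<mu>))"

lemma mean_finite: "finite A \<Longrightarrow> set_pmf p \<subseteq> A \<Longrightarrow> mean p = (\<Sum>x\<in>A. pmf p x * x)"
  unfolding mean_def by (subst integral_measure_pmf_real[where A = A]) (auto simp: mult.commute)

lemma one_minus_mean:
  assumes "finite A" "set_pmf p \<subseteq> A"
  shows "1 - mean p = (\<Sum>x\<in>A. pmf p x * (1 - x))"
proof -
  have "sum (pmf p) A = 1" using assms by (rule sum_pmf_eq_1)
  then show ?thesis
    using mean_finite[OF assms] by (simp add: right_diff_distrib sum_subtractf)
qed

text \<open>For an interior \<open>l\<close> this is the first-order condition for maximising
  \<open>l \<mapsto> E (ln (tilt \<mu> l x))\<close>, found by the intermediate value theorem. Only the signs of \<open>l \<phi>(l)\<close> and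
  \<open>(1 - l) \<phi>(l)\<close> matter for its derivative \<open>\<phi>\<close>, which covers the endpoints.\<close>

lemma exists_dual_parameter:
  assumes p: "finsupp01 p" and \<mu>: "\<mu> < 1"
  shows "\<exists>l. 0 \<le> l \<and> l \<le> 1 \<and> (\<forall>x\<in>set_pmf p. 0 < tilt \<mu> l x)
    \<and> (\<Sum>x\<in>set_pmf p. pmf p x / tilt \<mu> l x) \<le> 1
    \<and> (\<Sum>x\<in>set_pmf p. pmf p x / tilt \<mu> l x * (1 - x)) \<le> 1 - \<mu>"
proof -
  define S where "S = set_pmf p"
  have fin: "finite S" and S01: "\<And>x. x \<in> S \<Longrightarrow> 0 \<le> x \<and> x \<le> 1"
    using p by (auto simp: finsupp01_def S_def)
  have sum1: "sum (pmf p) S = 1" using fin by (intro sum_pmf_eq_1) (auto simp: S_def)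
  define v where "v x = (1 - x) / (1 - \<mu>)" for x
  have v0: "0 \<le> v x" if "x \<in> S" for x using S01[OF that] \<mu> by (auto simp: v_def)
  have tv: "tilt \<mu> l x = 1 - l + l * v x" for l x by (simp add: tilt_def v_def)
  define \<phi> where "\<phi> l = (\<Sum>x\<in>S. pmf p x * ((v x - 1) / tilt \<mu> l x))" for l
  have tpos: "0 < tilt \<mu> l x" if "x \<in> S" "0 \<le> l" "l < 1" for l x
    using v0[OF that(1)] that by (auto simp: tv intro!: add_pos_nonneg)
  have tpos1: "0 < tilt \<mu> l x" if "x \<in> S" "0 < v x" "0 \<le> l" "l \<le> 1" for l x
    using that by (cases "l = 1") (auto simp: tv intro!: add_pos_nonneg)
  have ivt: "\<exists>l. 0 \<le> l \<and> l \<le> b \<and> \<phi> l = 0"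
    if "0 \<le> \<phi> 0" "\<phi> b \<le> 0" "0 \<le> b" and pos: "\<And>l x. 0 \<le> l \<Longrightarrow> l \<le> b \<Longrightarrow> x \<in> S \<Longrightarrow> 0 < tilt \<mu> l x" for b
  proof -
    have "tilt \<mu> l x \<noteq> 0" if "l \<in> {0..b}" "x \<in> S" for l x
      using that pos[of l x] by auto
    then have "continuous_on {0..b} \<phi>"
      unfolding \<phi>_def tv by (intro continuous_intros) auto
    then show ?thesis using IVT2'[of \<phi> b 0 0] that by auto
  qed
  have "\<exists>l. 0 \<le> l \<and> l \<le> 1 \<and> (\<forall>x\<in>S. 0 < tilt \<mu> l x) \<and> 0 \<le> l * \<phi> l \<and> (1 - l) * \<phi> l \<le> 0"
  proof (cases "\<phi> 0 \<le> 0")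
    case True
    then show ?thesis using tpos by (intro exI[of _ 0]) auto
  next
    case pos: False
    show ?thesis
    proof (cases "\<forall>x\<in>S. 0 < v x")
      case True
      show ?thesis
      proof (cases "0 \<le> \<phi> 1")
        case t: True
        then show ?thesis using True tpos1 by (intro exI[of _ 1]) auto
      next
        case False
        then obtain l where "0 \<le> l" "l \<le> 1" "\<phi> l = 0"
          using ivt[of 1] pos True tpos1 by auto
        then show ?thesis using True tpos1 by (intro exI[of _ l]) auto
      qed
    next
      case False
      then obtain y where y: "y \<in> S" "v y = 0" using v0 by force
      define P where "P = pmf p y"
      have P: "0 < P" "P \<le> 1" using y by (auto simp: P_def S_def pmf_positive pmf_le_1)
      \<comment> \<open>When \<open>p\<close> charges 1, the tilt vanishes there at
        \<open>l = 1\<close>, so the search must stop at some \<open>b < 1\<close>. At this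
        \<open>b\<close> the tilt of the atom is \<open>P / 2\<close>, so its term in
        \<open>\<phi> b\<close> is -2, while \<open>b >= 1/2\<close> keeps the other terms at most 2
        in total.\<close>
      define b where "b = 1 - P / 2"
      have b: "1/2 \<le> b" "b < 1" using P by (auto simp: b_def)
      have "\<phi> b = pmf p y * ((v y - 1) / tilt \<mu> b y) + (\<Sum>x\<in>S - {y}. pmf p x * ((v x - 1) / tilt \<mu> b x))"
        unfolding \<phi>_def using fin y by (simp add: sum.remove)
      also have "pmf p y * ((v y - 1) / tilt \<mu> b y) = -2"
        using y P by (simp add: tv P_def[symmetric] b_def)
      also have "(\<Sum>x\<in>S - {y}. pmf p x * ((v x - 1) / tilt \<mu> b x)) \<le> (\<Sum>x\<in>S - {y}. pmf p x * 2)"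
      proof (intro sum_mono mult_left_mono)
        fix x assume "x \<in> S - {y}"
        then have x: "0 < tilt \<mu> b x" "0 \<le> v x" using tpos[of x b] v0 b by auto
        have "1/2 * v x \<le> b * v x" using b x(2) by (intro mult_right_mono) auto
        then have "v x - 1 \<le> 2 * tilt \<mu> b x" using b unfolding tv by simp
        then show "(v x - 1) / tilt \<mu> b x \<le> 2" using x(1) by (simp add: divide_le_eq)
      qed simp
      also have "(\<Sum>x\<in>S - {y}. pmf p x * 2) \<le> (\<Sum>x\<in>S. pmf p x * 2)"
        using fin by (intro sum_mono2) auto
      also have "\<dots> = 2" using sum1 by (simp add: sum_distrib_right[symmetric])
      finally have "\<phi> b \<le> 0" by simp
      then obtain l where "0 \<le> l" "l \<le> b" "\<phi> l = 0"
        using ivt[of b] pos b tpos by fastforce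
      then show ?thesis using b tpos by (intro exI[of _ l]) auto
    qed
  qed
  then obtain l where l: "0 \<le> l" "l \<le> 1" "\<And>x. x \<in> S \<Longrightarrow> 0 < tilt \<mu> l x" "0 \<le> l * \<phi> l" "(1 - l) * \<phi> l \<le> 0"
    by blast
  \<comment> \<open>Both sums are affine in \<open>\<phi> l\<close>:
    \<open>1 / tilt = 1 - l (v - 1) / tilt\<close> gives mass \<open>1 - l * \<phi> l\<close>, and
    \<open>v / tilt = 1 + (1 - l) (v - 1) / tilt\<close> gives \<open>1 + (1 - l) * \<phi> l\<close>
    for the second sum divided by \<open>1 - \<mu>\<close>.\<close>
  have "(\<Sum>x\<in>S. pmf p x / tilt \<mu> l x) = (\<Sum>x\<in>S. pmf p x - l * (pmf p x * ((v x - 1) / tilt \<mu> l x)))"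
  proof (intro sum.cong refl)
    fix x assume "x \<in> S"
    have "tilt \<mu> l x = 1 + l * (v x - 1)" by (simp add: tv algebra_simps)
    then have "1 / tilt \<mu> l x = 1 - l * ((v x - 1) / tilt \<mu> l x)"
      using l(3)[OF \<open>x \<in> S\<close>] by (simp add: field_simps)
    then have "pmf p x * (1 / tilt \<mu> l x) = pmf p x * (1 - l * ((v x - 1) / tilt \<mu> l x))" by simp
    then show "pmf p x / tilt \<mu> l x = pmf p x - l * (pmf p x * ((v x - 1) / tilt \<mu> l x))"
      by (simp add: algebra_simps)
  qed
  also have "\<dots> = 1 - l * \<phi> l" using sum1 by (simp add: sum_subtractf \<phi>_def sum_distrib_left)
  finally have 1: "(\<Sum>x\<in>S. pmf p x / tilt \<mu> l x) \<le> 1" using l by simp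
  have "(\<Sum>x\<in>S. pmf p x / tilt \<mu> l x * (1 - x))
      = (\<Sum>x\<in>S. (1 - \<mu>) * (pmf p x + (1 - l) * (pmf p x * ((v x - 1) / tilt \<mu> l x))))"
  proof (intro sum.cong refl)
    fix x assume "x \<in> S"
    have x: "1 - x = (1 - \<mu>) * v x" using \<mu> by (simp add: v_def)
    have "v x / tilt \<mu> l x = 1 + (1 - l) * ((v x - 1) / tilt \<mu> l x)"
      using l(3)[OF \<open>x \<in> S\<close>] by (simp add: field_simps tv)
    moreover have "pmf p x / tilt \<mu> l x * ((1 - \<mu>) * v x) = (1 - \<mu>) * pmf p x * (v x / tilt \<mu> l x)"
      by simp
    ultimately show "pmf p x / tilt \<mu> l x * (1 - x)
        = (1 - \<mu>) * (pmf p x + (1 - l) * (pmf p x * ((v x - 1) / tilt \<mu> l x)))"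
      unfolding x by (simp only: distrib_left mult_1_right mult.assoc mult.left_commute)
  qed
  also have "\<dots> = (1 - \<mu>) * (1 + (1 - l) * \<phi> l)"
    unfolding sum_distrib_left[symmetric] sum.distrib sum1 \<phi>_def ..
  also have "\<dots> \<le> (1 - \<mu>) * 1" using l \<mu> by (intro mult_left_mono) auto
  finally have 2: "(\<Sum>x\<in>S. pmf p x / tilt \<mu> l x * (1 - x)) \<le> 1 - \<mu>" by simp
  show ?thesis
    using 1 2 l(1,2,3) by (intro exI[of _ l] conjI ballI) (simp_all add: S_def)
qed

text \<open>The witness has density \<open>(1 - \<eta>) / tilt \<mu> l\<close> with respect to \<open>p\<close>, and its missing mass is put at \<open>1\<close>.
  A positive \<open>\<eta>\<close> pushes the mean strictly above \<open>\<mu>\<close>, as the definition of \<open>Kinf\<close> demands.\<close>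

lemma KL_achieves_dual:
  assumes p: "finsupp01 p" and \<mu>: "\<mu> < 1"
  shows "\<exists>l. 0 \<le> l \<and> l \<le> 1 \<and> (\<forall>x\<in>set_pmf p. 0 < tilt \<mu> l x) \<and>
    (\<forall>\<eta>. 0 \<le> \<eta> \<and> \<eta> < 1 \<longrightarrow> (\<exists>q. set_pmf q \<subseteq> set_pmf p \<union> {1} \<and> (1 - \<eta>) * \<mu> + \<eta> \<le> mean q
      \<and> KL p q \<le> ereal ((\<Sum>x\<in>set_pmf p. pmf p x * ln (tilt \<mu> l x)) - ln (1 - \<eta>))))"
proof -
  define S where "S = set_pmf p"
  have fin: "finite S" and S01: "\<And>x. x \<in> S \<Longrightarrow> 0 \<le> x \<and> x \<le> 1"
    using p by (auto simp: finsupp01_def S_def)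
  have sum1: "sum (pmf p) S = 1" using fin by (intro sum_pmf_eq_1) (auto simp: S_def)
  obtain l where l: "0 \<le> l" "l \<le> 1" "\<And>x. x \<in> S \<Longrightarrow> 0 < tilt \<mu> l x"
    "(\<Sum>x\<in>S. pmf p x / tilt \<mu> l x) \<le> 1"
    "(\<Sum>x\<in>S. pmf p x / tilt \<mu> l x * (1 - x)) \<le> 1 - \<mu>"
    using exists_dual_parameter[OF assms] unfolding S_def by blast
  have "\<exists>q. set_pmf q \<subseteq> S \<union> {1} \<and> (1 - \<eta>) * \<mu> + \<eta> \<le> mean q
      \<and> KL p q \<le> ereal ((\<Sum>x\<in>S. pmf p x * ln (tilt \<mu> l x)) - ln (1 - \<eta>))"
    if \<eta>: "0 \<le> \<eta>" "\<eta> < 1" for \<eta>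
  proof -
    define r where "r x = (if x \<in> S then (1 - \<eta>) * (pmf p x / tilt \<mu> l x) else 0)" for x
    define w where "w x = r x + (if x = 1 then 1 - sum r S else 0)" for x
    have r0: "0 \<le> r x" for x using l(3)[of x] \<eta> by (auto simp: r_def less_imp_le)
    have "sum r S = (1 - \<eta>) * (\<Sum>x\<in>S. pmf p x / tilt \<mu> l x)"
      by (simp add: r_def sum_distrib_left)
    also have "\<dots> \<le> (1 - \<eta>) * 1" using \<eta> l by (intro mult_left_mono) auto
    finally have rS: "sum r S \<le> 1" using \<eta> by simp
    have rS': "sum r (S \<union> {1}) = sum r S" using fin
      by (intro sum.mono_neutral_right) (auto simp: r_def)
    have "sum w (S \<union> {1}) = 1" using fin rS' by (simp add: w_def sum.distrib sum.delta)
    moreover have w0: "w x \<ge> 0" for x using r0[of x] rS by (auto simp: w_def)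
    ultimately obtain q where q: "set_pmf q \<subseteq> S \<union> {1}" "\<And>x. x \<in> S \<union> {1} \<Longrightarrow> pmf q x = w x"
      using finite_pmf_exists[of "S \<union> {1}" w] fin by auto
    have "1 - mean q = (\<Sum>x\<in>S \<union> {1}. w x * (1 - x))"
      using one_minus_mean[OF _ q(1)] fin q(2) by simp
    \<comment> \<open>The mass added at 1 does not affect \<open>1 - mean q\<close>, because its
      factor \<open>1 - x\<close> is zero.\<close>
    also have "\<dots> = (\<Sum>x\<in>S \<union> {1}. r x * (1 - x))"
      by (intro sum.cong) (auto simp: w_def)
    also have "\<dots> = (\<Sum>x\<in>S. r x * (1 - x))" using fin
      by (intro sum.mono_neutral_right) (auto simp: r_def)
    also have "\<dots> = (1 - \<eta>) * (\<Sum>x\<in>S. pmf p x / tilt \<mu> l x * (1 - x))"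
      by (simp add: r_def sum_distrib_left mult.assoc)
    also have "\<dots> \<le> (1 - \<eta>) * (1 - \<mu>)" using \<eta> l by (intro mult_left_mono) auto
    finally have m: "(1 - \<eta>) * \<mu> + \<eta> \<le> mean q" by (simp add: algebra_simps)
    have qr: "(1 - \<eta>) * (pmf p x / tilt \<mu> l x) \<le> pmf q x" if "x \<in> S" for x
      using that q(2)[of x] rS by (auto simp: w_def r_def)
    have pp: "0 < pmf p x" if "x \<in> S" for x using that by (simp add: S_def pmf_positive)
    have qp: "0 < pmf q x" if "x \<in> S" for x
      using qr[OF that] pp[OF that] l(3)[OF that] \<eta>
      by (smt (verit, best) divide_pos_pos mult_pos_pos)
    have sub: "S \<subseteq> set_pmf q" using qp by (force simp: set_pmf_iff)
    have "(\<Sum>x\<in>S. pmf p x * ln (pmf p x / pmf q x)) \<le> (\<Sum>x\<in>S. pmf p x * (ln (tilt \<mu> l x) - ln (1 - \<eta>)))"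
    proof (intro sum_mono mult_left_mono)
      fix x assume x: "x \<in> S"
      have "pmf p x / pmf q x \<le> tilt \<mu> l x / (1 - \<eta>)"
        using qr[OF x] qp[OF x] l(3)[OF x] \<eta> by (simp add: field_simps)
      then have "ln (pmf p x / pmf q x) \<le> ln (tilt \<mu> l x / (1 - \<eta>))"
        using pp[OF x] qp[OF x] l(3)[OF x] \<eta> by (subst ln_le_cancel_iff) auto
      then show "ln (pmf p x / pmf q x) \<le> ln (tilt \<mu> l x) - ln (1 - \<eta>)"
        using l(3)[OF x] \<eta> by (simp add: ln_div)
    qed simp
    also have "\<dots> = (\<Sum>x\<in>S. pmf p x * ln (tilt \<mu> l x)) - ln (1 - \<eta>)"
      using sum1 by (simp add: right_diff_distrib sum_subtractf sum_distrib_right[symmetric])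
    finally have "KL p q \<le> ereal ((\<Sum>x\<in>S. pmf p x * ln (tilt \<mu> l x)) - ln (1 - \<eta>))"
      using sub by (simp add: KL_def S_def)
    with q(1) m show ?thesis by blast
  qed
  then show ?thesis using l(1,2,3) unfolding S_def by blast
qed

text \<open>Weak duality. As \<open>mean q\<close> is at least \<open>\<mu>\<close>, the tilt is
  nonnegative with \<open>q\<close>-expectation at most 1, and \<open>ln z <= z - 1\<close> at
  \<open>z = pmf q x * tilt \<mu> l x / pmf p x\<close> bounds the difference by that expectation
  minus 1.\<close>

lemma dual_le_KL:
  assumes q: "finsupp01 q" and \<mu>: "\<mu> < 1" "\<mu> \<le> mean q" and l: "0 \<le> l" "l \<le> 1"
    and pos: "\<And>x. x \<in> set_pmf p \<Longrightarrow> 0 < tilt \<mu> l x"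
  shows "ereal (\<Sum>x\<in>set_pmf p. pmf p x * ln (tilt \<mu> l x)) \<le> KL p q"
proof (cases "set_pmf p \<subseteq> set_pmf q")
  case sub: True
  define S where "S = set_pmf p"
  have finq: "finite (set_pmf q)" and q01: "\<And>x. x \<in> set_pmf q \<Longrightarrow> 0 \<le> x \<and> x \<le> 1"
    using q by (auto simp: finsupp01_def)
  have fin: "finite S" using sub finq finite_subset unfolding S_def by blast
  have sum1: "sum (pmf p) S = 1" using fin by (intro sum_pmf_eq_1) (auto simp: S_def)
  have sumq: "sum (pmf q) (set_pmf q) = 1" using finq by (intro sum_pmf_eq_1) auto
  have t0: "0 \<le> tilt \<mu> l x" if "x \<in> set_pmf q" for x
    using q01[OF that] l \<mu> by (auto simp: tilt_def intro!: add_nonneg_nonneg mult_nonneg_nonneg)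
  have "(\<Sum>x\<in>S. pmf q x * tilt \<mu> l x) \<le> (\<Sum>x\<in>set_pmf q. pmf q x * tilt \<mu> l x)"
    using finq sub t0 by (intro sum_mono2) (auto simp: S_def)
  also have "\<dots> = (1 - l) + l / (1 - \<mu>) * (1 - mean q)"
    unfolding one_minus_mean[OF finq order_refl] tilt_def
    using sumq by (simp add: distrib_left sum.distrib sum_distrib_right[symmetric] sum_distrib_left
      mult.left_commute)
  also have "\<dots> \<le> (1 - l) + l / (1 - \<mu>) * (1 - \<mu>)"
    using \<mu> l by (intro add_left_mono mult_left_mono) auto
  also have "\<dots> = 1" using \<mu> by simp
  finally have le1: "(\<Sum>x\<in>S. pmf q x * tilt \<mu> l x) \<le> 1" .
  have "(\<Sum>x\<in>S. pmf p x * ln (tilt \<mu> l x)) - (\<Sum>x\<in>S. pmf p x * ln (pmf p x / pmf q x))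
      = (\<Sum>x\<in>S. pmf p x * (ln (tilt \<mu> l x) - ln (pmf p x / pmf q x)))"
    by (simp add: sum_subtractf right_diff_distrib)
  also have "\<dots> \<le> (\<Sum>x\<in>S. pmf q x * tilt \<mu> l x - pmf p x)"
  proof (intro sum_mono)
    fix x assume x: "x \<in> S"
    have a: "0 < pmf p x" "0 < pmf q x" "0 < tilt \<mu> l x"
      using x sub pos by (auto simp: S_def pmf_positive)
    have "ln (tilt \<mu> l x) - ln (pmf p x / pmf q x) = ln (pmf q x * tilt \<mu> l x / pmf p x)"
      using a by (simp add: ln_div ln_mult)
    also have "\<dots> \<le> pmf q x * tilt \<mu> l x / pmf p x - 1" using a by (intro ln_le_minus_one) auto
    finally have "pmf p x * (ln (tilt \<mu> l x) - ln (pmf p x / pmf q x))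
       \<le> pmf p x * (pmf q x * tilt \<mu> l x / pmf p x - 1)" using a by (intro mult_left_mono) auto
    also have "\<dots> = pmf q x * tilt \<mu> l x - pmf p x" using a by (simp add: field_simps)
    finally show "pmf p x * (ln (tilt \<mu> l x) - ln (pmf p x / pmf q x))
       \<le> pmf q x * tilt \<mu> l x - pmf p x" .
  qed
  also have "\<dots> \<le> 0" using le1 sum1 by (simp add: sum_subtractf)
  finally show ?thesis using sub by (simp add: KL_def S_def)
qed (simp add: KL_def)

text \<open>The bound on \<open>\<kappa>\<close> comes from the witnesses of
  \<open>KL_achieves_dual\<close> as \<open>\<eta>\<close> tends to 0. Positivity comes from weak
  duality at a second, small parameter \<open>m\<close>, where the expected log-tilt is visibly
  positive.\<close>

lemma Kinf_dual:
  assumes p: "finsupp01 p" and \<mu>: "mean p < \<mu>" "\<mu> < 1"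
  obtains \<kappa> l where "0 < \<kappa>" "Kinf p \<mu> = ereal \<kappa>" "0 \<le> l" "l \<le> 1"
    "\<And>x. x \<in> set_pmf p \<Longrightarrow> 0 < tilt \<mu> l x"
    "\<kappa> \<le> (\<Sum>x\<in>set_pmf p. pmf p x * ln (tilt \<mu> l x))"
proof -
  define S where "S = set_pmf p"
  have fin: "finite S" and S01: "\<And>x. x \<in> S \<Longrightarrow> 0 \<le> x \<and> x \<le> 1"
    using p by (auto simp: finsupp01_def S_def)
  have sum1: "sum (pmf p) S = 1" using fin by (intro sum_pmf_eq_1) (auto simp: S_def)
  obtain l where l: "0 \<le> l" "l \<le> 1" "\<And>x. x \<in> S \<Longrightarrow> 0 < tilt \<mu> l x"
    and q: "\<And>\<eta>. 0 \<le> \<eta> \<and> \<eta> < 1 \<Longrightarrow> (\<exists>q. set_pmf q \<subseteq> S \<union> {1} \<and> (1 - \<eta>) * \<mu> + \<eta> \<le> mean q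
      \<and> KL p q \<le> ereal ((\<Sum>x\<in>S. pmf p x * ln (tilt \<mu> l x)) - ln (1 - \<eta>)))"
    using KL_achieves_dual[OF p \<mu>(2)] unfolding S_def by blast
  define G where "G = (\<Sum>x\<in>S. pmf p x * ln (tilt \<mu> l x))"
  have up: "Kinf p \<mu> \<le> ereal (G - ln (1 - \<eta>))" if \<eta>: "0 < \<eta>" "\<eta> < 1" for \<eta>
  proof -
    obtain q where q: "set_pmf q \<subseteq> S \<union> {1}" "(1 - \<eta>) * \<mu> + \<eta> \<le> mean q"
      "KL p q \<le> ereal (G - ln (1 - \<eta>))" using q[of \<eta>] \<eta> unfolding G_def by auto
    have "0 < \<eta> * (1 - \<mu>)" using \<eta> \<mu> by simp
    then have "\<mu> < mean q" using q(2) by (simp add: algebra_simps)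
    moreover have "finsupp01 q"
      using finite_subset[OF q(1)] q(1) fin S01 unfolding finsupp01_def by auto
    ultimately have "Kinf p \<mu> \<le> KL p q" unfolding Kinf_def by (intro Inf_lower) auto
    with q(3) show ?thesis by simp
  qed
  have "\<exists>\<epsilon>>0. \<exists>m. 0 < m \<and> m < 1 \<and> \<epsilon> \<le> (\<Sum>x\<in>S. pmf p x * ln (tilt \<mu> m x))"
  proof -
    \<comment> \<open>\<open>\<psi>\<close> is the derivative of the expected log-tilt. It is
      positive at 0 because \<open>mean p < \<mu>\<close>, hence by continuity at some
      \<open>m > 0\<close>, and \<open>ln t >= 1 - 1 / t\<close> gives the lower bound
      \<open>m * \<psi> m\<close>.\<close>
    define \<psi> where "\<psi> m = (\<Sum>x\<in>S. pmf p x * (((1 - x) / (1 - \<mu>) - 1) / tilt \<mu> m x))" for m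
    have "\<psi> 0 = (\<Sum>x\<in>S. pmf p x * (1 - x) / (1 - \<mu>) - pmf p x)"
      by (simp add: \<psi>_def tilt_def right_diff_distrib)
    also have "\<dots> = (\<Sum>x\<in>S. pmf p x * (1 - x)) / (1 - \<mu>) - sum (pmf p) S"
      by (simp only: sum_subtractf sum_divide_distrib)
    also have "\<dots> = (1 - mean p) / (1 - \<mu>) - 1"
      using sum1 one_minus_mean[OF fin, of p] by (simp add: S_def)
    finally have "0 < \<psi> 0" using \<mu> by simp
    moreover have "isCont \<psi> 0"
      unfolding \<psi>_def tilt_def by (intro continuous_intros) auto
    ultimately have "eventually (\<lambda>m. 0 < \<psi> m) (at_right 0)"
      using order_tendstoD(1)[of \<psi> "\<psi> 0" "at 0" 0] by (simp add: isCont_def eventually_at_split)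
    moreover have "eventually (\<lambda>m::real. m < 1) (at_right 0)" "eventually (\<lambda>m::real. 0 < m) (at_right 0)"
      by real_asymp+
    ultimately have "eventually (\<lambda>m. 0 < \<psi> m \<and> m < 1 \<and> 0 < m) (at_right 0)"
      by eventually_elim auto
    then obtain m where m: "0 < \<psi> m" "m < 1" "0 < m"
      using eventually_happens[of _ "at_right (0::real)"] by auto
    have "m * \<psi> m = (\<Sum>x\<in>S. pmf p x * (m * (((1 - x) / (1 - \<mu>) - 1) / tilt \<mu> m x)))"
      by (simp add: \<psi>_def sum_distrib_left mult.left_commute)
    also have "\<dots> \<le> (\<Sum>x\<in>S. pmf p x * ln (tilt \<mu> m x))"
    proof (intro sum_mono mult_left_mono)
      fix x assume x: "x \<in> S"
      have t: "0 < tilt \<mu> m x"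
        using S01[OF x] m \<mu> by (auto simp: tilt_def intro!: add_pos_nonneg)
      have "m * (((1 - x) / (1 - \<mu>) - 1) / tilt \<mu> m x) = 1 - 1 / tilt \<mu> m x"
      proof -
        have "m * ((1 - x) / (1 - \<mu>) - 1) = tilt \<mu> m x - 1" by (simp add: tilt_def algebra_simps)
        then have "m * ((1 - x) / (1 - \<mu>) - 1) / tilt \<mu> m x = (tilt \<mu> m x - 1) / tilt \<mu> m x"
          by (simp only:)
        also have "\<dots> = 1 - 1 / tilt \<mu> m x" using t by (simp add: diff_divide_distrib)
        finally show ?thesis by (simp only: times_divide_eq_right)
      qed
      also have "\<dots> \<le> ln (tilt \<mu> m x)"
        using ln_le_minus_one[of "1 / tilt \<mu> m x"] t by (simp add: ln_div)
      finally show "m * (((1 - x) / (1 - \<mu>) - 1) / tilt \<mu> m x) \<le> ln (tilt \<mu> m x)" .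
    qed simp
    finally show ?thesis using m by (intro exI[of _ "m * \<psi> m"]) auto
  qed
  then obtain \<epsilon> m where m: "0 < \<epsilon>" "0 < m" "m < 1" "\<epsilon> \<le> (\<Sum>x\<in>S. pmf p x * ln (tilt \<mu> m x))"
    by blast
  have tm: "0 < tilt \<mu> m x" if "x \<in> S" for x
    using S01[OF that] m \<mu> by (auto simp: tilt_def intro!: add_pos_nonneg)
  have lo: "ereal \<epsilon> \<le> Kinf p \<mu>" unfolding Kinf_def
  proof (rule Inf_greatest)
    fix z assume "z \<in> {KL p q |q. finsupp01 q \<and> \<mu> < mean q}"
    then obtain q where q: "z = KL p q" "finsupp01 q" "\<mu> < mean q" by blast
    have "ereal (\<Sum>x\<in>set_pmf p. pmf p x * ln (tilt \<mu> m x)) \<le> KL p q"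
      using q m \<mu> tm by (intro dual_le_KL) (auto simp: S_def)
    then show "ereal \<epsilon> \<le> z" using m(4) q(1) unfolding S_def
      by (meson ereal_less_eq(3) order_trans)
  qed
  from up[of "1/2"] lo obtain \<kappa> where \<kappa>: "Kinf p \<mu> = ereal \<kappa>" by (cases "Kinf p \<mu>") auto
  have "\<kappa> \<le> G"
  proof (rule tendsto_lowerbound)
    show "((\<lambda>\<eta>. G - ln (1 - \<eta>)) \<longlongrightarrow> G) (at_right 0)" by real_asymp
    have "eventually (\<lambda>\<eta>::real. 0 < \<eta> \<and> \<eta> < 1) (at_right 0)"
      by (auto simp: eventually_at_right_field intro: exI[of _ 1])
    then show "eventually (\<lambda>\<eta>. \<kappa> \<le> G - ln (1 - \<eta>)) (at_right 0)"
      by eventually_elim (use up \<kappa> in auto)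
  qed auto
  then show ?thesis using that[of \<kappa> l] \<kappa> lo m(1) l unfolding G_def S_def by auto
qed

section \<open>The bandit process\<close>

abbreviation E :: "'a pmf \<Rightarrow> ('a \<Rightarrow> real) \<Rightarrow> real" where
  "E p f \<equiv> measure_pmf.expectation p f"

lemma E_mono:
  assumes "finite (set_pmf p)" "\<And>x. x \<in> set_pmf p \<Longrightarrow> f x \<le> g x"
  shows "E p f \<le> E p g"
  using assms by (intro integral_mono_AE) (auto simp: AE_measure_pmf_iff integrable_measure_pmf_finite)

lemma E_cong: "(\<And>x. x \<in> set_pmf p \<Longrightarrow> f x = g x) \<Longrightarrow> E p f = E p g"
  by (intro integral_cong_AE) (auto simp: AE_measure_pmf_iff)

lemma E_add: "finite (set_pmf p) \<Longrightarrow> E p (\<lambda>x. f x + g x) = E p f + E p g"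
  by (intro Bochner_Integration.integral_add) (auto simp: integrable_measure_pmf_finite)

lemma E_sum: "finite (set_pmf p) \<Longrightarrow> E p (\<lambda>x. \<Sum>i\<in>I. f i x) = (\<Sum>i\<in>I. E p (f i))"
  by (intro Bochner_Integration.integral_sum) (auto simp: integrable_measure_pmf_finite)

lemma E_bind:
  assumes "finite (set_pmf p)" "\<And>x. x \<in> set_pmf p \<Longrightarrow> finite (set_pmf (f x))"
  shows "E (bind_pmf p f) g = E p (\<lambda>x. E (f x) g)"
  using assms by (subst pmf_expectation_bind[where A = "set_pmf p"])
    (auto simp: integral_measure_pmf[where A = "set_pmf p"])

lemma set_replicate_pmf_finite: "finite (set_pmf p) \<Longrightarrow> finite (set_pmf (replicate_pmf n p))"
  by (simp add: set_replicate_pmf lists_eq_set finite_lists_length_eq)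

lemma E_replicate_Suc:
  assumes "finite (set_pmf p)"
  shows "E (replicate_pmf (Suc n) p) g = E p (\<lambda>x. E (replicate_pmf n p) (\<lambda>xs. g (x # xs)))"
proof -
  have "replicate_pmf (Suc n) p = bind_pmf p (\<lambda>x. map_pmf ((#) x) (replicate_pmf n p))"
    by (simp add: map_pmf_def)
  then show ?thesis using assms
    by (simp only:) (subst E_bind, auto simp: set_replicate_pmf_finite)
qed

lemma E_replicate_prod:
  assumes "finite (set_pmf p)"
  shows "E (replicate_pmf n p) (\<lambda>xs. \<Prod>i<n. \<phi> i (xs ! i)) = (\<Prod>i<n. E p (\<phi> i))"
proof (induction n arbitrary: \<phi>)
  case (Suc n)
  show ?case
    by (subst E_replicate_Suc[OF assms]) (simp only: prod.lessThan_Suc_shift nth_Cons_0 nth_Cons_Suc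
      Bochner_Integration.integral_mult_right_zero Bochner_Integration.integral_mult_left_zero Suc.IH[of "\<lambda>i. \<phi> (Suc i)"])
qed simp

definition rewards :: "history \<Rightarrow> nat \<Rightarrow> real list" where
  "rewards h b = map snd (filter (\<lambda>p. fst p = b) h)"

lemma Npulls_rewards: "Npulls h b = length (rewards h b)"
  by (simp add: Npulls_def rewards_def)

lemma rewards_snoc: "rewards (h @ [(b', y)]) b = (if b' = b then rewards h b @ [y] else rewards h b)"
  by (simp add: rewards_def)

text \<open>Counting and martingale arguments work for any policy with this initialisation; the
  argmax rule enters through \<open>klucb_policy\<close> in \<open>E_Npulls_le\<close>.\<close>

locale bandit =
  fixes K :: nat and nu :: "nat \<Rightarrow> real pmf" and pol :: "history \<Rightarrow> nat"
  assumes fin: "b < K \<Longrightarrow> finite (set_pmf (nu b))"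
    and pol_less: "pol h < K"
    and pol_init: "length h < K \<Longrightarrow> pol h = length h"
begin

abbreviation H :: "nat \<Rightarrow> history pmf" where
  "H \<equiv> hist pol nu"

lemma finite_H: "finite (set_pmf (H t))"
  by (induction t) (auto simp: fin pol_less)

lemma E_H_Suc: "E (H (Suc t)) g = E (H t) (\<lambda>h. E (nu (pol h)) (\<lambda>y. g (h @ [(pol h, y)])))"
  unfolding hist.simps by (subst E_bind) (auto simp: finite_H fin pol_less)

lemma length_H: "h \<in> set_pmf (H t) \<Longrightarrow> length h = t"
  by (induction t arbitrary: h) auto

lemma rewards_H: "h \<in> set_pmf (H t) \<Longrightarrow> set (rewards h b) \<subseteq> set_pmf (nu b)"
proof (induction t arbitrary: h)
  case (Suc t)
  then show ?case by (fastforce simp: rewards_snoc split: if_splits)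
qed (simp add: rewards_def)

lemma Npulls_snoc: "Npulls (h @ [(b', y)]) b = Npulls h b + of_bool (b' = b)"
  by (simp add: Npulls_def)

lemma Npulls_pos: "h \<in> set_pmf (H t) \<Longrightarrow> b < K \<Longrightarrow> b < t \<Longrightarrow> 0 < Npulls h b"
proof (induction t arbitrary: h)
  case (Suc t)
  then obtain h' y where h: "h' \<in> set_pmf (H t)" "h = h' @ [(pol h', y)]" by auto
  show ?case
  proof (cases "b = t")
    case True
    then have "pol h' = b" using pol_init length_H[OF h(1)] Suc.prems by auto
    then show ?thesis by (simp add: h Npulls_snoc)
  next
    case False
    then show ?thesis using Suc h by (simp add: Npulls_snoc)
  qed
qed simp

lemma E_Npulls: "E (H T) (\<lambda>h. real (Npulls h a)) = (\<Sum>t<T. E (H t) (\<lambda>h. of_bool (pol h = a)))"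
proof (induction T)
  case (Suc T)
  have "E (H (Suc T)) (\<lambda>h. real (Npulls h a)) = E (H T) (\<lambda>h. real (Npulls h a) + of_bool (pol h = a))"
    by (subst E_H_Suc) (simp add: Npulls_snoc)
  then show ?case using Suc by (simp add: E_add finite_H)
qed (simp add: Npulls_def)

text \<open>Each value of the pull counter is left at most once, so the sum telescopes.\<close>

lemma sum_pulls_telescope:
  "(\<Sum>t<T. E (H t) (\<lambda>h. of_bool (pol h = a \<and> Npulls h a = n \<and> Q (rewards h a))))
    = E (H T) (\<lambda>h. of_bool (n < Npulls h a \<and> Q (take n (rewards h a))))"
proof (induction T)
  case (Suc T)
  have "of_bool (n < Npulls (h @ [(pol h, y)]) a \<and> Q (take n (rewards (h @ [(pol h, y)]) a)))
    = (of_bool (n < Npulls h a \<and> Q (take n (rewards h a)))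
        + of_bool (pol h = a \<and> Npulls h a = n \<and> Q (rewards h a)) :: real)" for h y
    by (cases "n < Npulls h a"; cases "n = Npulls h a")
      (auto simp: Npulls_rewards rewards_snoc)
  then have "E (H (Suc T)) (\<lambda>h. of_bool (n < Npulls h a \<and> Q (take n (rewards h a))))
    = E (H T) (\<lambda>h. of_bool (n < Npulls h a \<and> Q (take n (rewards h a)))
        + of_bool (pol h = a \<and> Npulls h a = n \<and> Q (rewards h a)))"
    unfolding E_H_Suc by simp
  then show ?case using Suc by (simp add: E_add finite_H)
qed (simp add: Npulls_def)

text \<open>Completing the observed rewards of an arm by fresh independent samples gives a martingale.\<close>

lemma E_take_rewards_le:
  assumes b: "b < K" and F: "\<And>xs. 0 \<le> F xs"
  shows "E (H t) (\<lambda>h. of_bool (n \<le> Npulls h b) * F (take n (rewards h b))) \<le> E (replicate_pmf n (nu b)) F"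
proof -
  define G where "G xs = E (replicate_pmf (n - length xs) (nu b)) (\<lambda>zs. F (take n (xs @ zs)))" for xs
  have step: "E (nu b) (\<lambda>y. G (xs @ [y])) = G xs" for xs
  proof (cases "length xs < n")
    case True
    then obtain m where m: "n - length xs = Suc m" "n - Suc (length xs) = m"
      by (metis Suc_diff_Suc)
    then show ?thesis
      unfolding G_def by (simp only: E_replicate_Suc[OF fin[OF b]] length_append_singleton append_assoc append.simps)
  next
    case False
    then show ?thesis by (simp add: G_def)
  qed
  \<comment> \<open>A pull of \<open>b\<close> appends one sample and shortens the completion by
    one, which \<open>step\<close> averages out; other pulls leave the list unchanged.\<close>
  have "E (H t) (\<lambda>h. G (rewards h b)) = G []"
  proof (induction t)
    case (Suc t)
    have "E (nu (pol h)) (\<lambda>y. G (rewards (h @ [(pol h, y)]) b)) = G (rewards h b)" for h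
      by (cases "pol h = b") (auto simp: rewards_snoc step)
    then show ?case using Suc by (simp only: E_H_Suc)
  qed (simp add: rewards_def)
  moreover have "G [] = E (replicate_pmf n (nu b)) F"
    unfolding G_def using set_replicate_pmf[of n "nu b"] by (auto intro!: E_cong)
  moreover have "E (H t) (\<lambda>h. of_bool (n \<le> Npulls h b) * F (take n (rewards h b))) \<le> E (H t) (\<lambda>h. G (rewards h b))"
  proof (intro E_mono finite_H)
    fix h
    have "0 \<le> G (rewards h b)" unfolding G_def by (intro integral_nonneg_AE) (auto simp: F)
    moreover have "G (rewards h b) = F (take n (rewards h b))" if "n \<le> Npulls h b"
      using that by (simp add: G_def Npulls_rewards)
    ultimately show "of_bool (n \<le> Npulls h b) * F (take n (rewards h b)) \<le> G (rewards h b)" by auto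
  qed
  ultimately show ?thesis by simp
qed

end

section \<open>The index in terms of likelihood ratios\<close>

lemma set_emp: "rewards h b \<noteq> [] \<Longrightarrow> set_pmf (emp h b) = set (rewards h b)"
  by (simp add: emp_def rewards_def[symmetric])

lemma sum_count_list:
  "finite A \<Longrightarrow> set xs \<subseteq> A \<Longrightarrow> (\<Sum>x\<in>A. real (count (mset xs) x) * \<phi> x) = (\<Sum>x\<leftarrow>xs. \<phi> x)"
proof (induction xs)
  case (Cons y ys)
  have "(\<Sum>x\<in>A. real (count (mset (y # ys)) x) * \<phi> x)
    = (\<Sum>x\<in>A. real (count (mset ys) x) * \<phi> x + (if x = y then \<phi> x else 0))"
    by (intro sum.cong) (auto simp: algebra_simps)
  then show ?case using Cons by (simp add: sum.distrib sum.delta)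
qed simp

lemma sum_emp:
  assumes "rewards h b \<noteq> []"
  shows "(\<Sum>x\<in>set_pmf (emp h b). pmf (emp h b) x * \<phi> x) = (\<Sum>x\<leftarrow>rewards h b. \<phi> x) / real (Npulls h b)"
proof -
  have "(\<Sum>x\<in>set_pmf (emp h b). pmf (emp h b) x * \<phi> x)
      = (\<Sum>x\<in>set (rewards h b). real (count (mset (rewards h b)) x) * \<phi> x) / real (Npulls h b)"
    using assms by (simp add: emp_def rewards_def[symmetric] Npulls_rewards sum_divide_distrib)
  then show ?thesis by (simp add: sum_count_list)
qed

lemma finsupp01_mean_le: "finsupp01 q \<Longrightarrow> mean q \<le> 1"
  using one_minus_mean[of "set_pmf q" q] sum_nonneg[of "set_pmf q" "\<lambda>x. pmf q x * (1 - x)"]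
  unfolding finsupp01_def by fastforce

lemma finsupp01_emp_subset:
  assumes "rewards h b \<noteq> []" "set (rewards h b) \<subseteq> {0..1}" "set_pmf q \<subseteq> set_pmf (emp h b) \<union> {1}"
  shows "finsupp01 q"
  using assms finite_subset[OF assms(3)] by (fastforce simp: finsupp01_def set_emp)

text \<open>Otherwise the witness of \<open>KL_achieves_dual\<close> with \<open>\<eta> = 0\<close>
  would be feasible for the index and have mean at least \<open>\<mu>\<close>, contradicting
  \<open>ucb h b < \<mu>\<close>.\<close>

lemma ucb_less_imp_dual:
  assumes h: "rewards h b \<noteq> []" "set (rewards h b) \<subseteq> {0..1}" and u: "ucb h b < \<mu>" "\<mu> < 1"
  shows "\<exists>l. 0 \<le> l \<and> l \<le> 1 \<and> (\<forall>x\<in>set (rewards h b). 0 < tilt \<mu> l x)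
    \<and> fexp (length h) < (\<Sum>x\<leftarrow>rewards h b. ln (tilt \<mu> l x))"
proof -
  have "finsupp01 (emp h b)" by (rule finsupp01_emp_subset[OF h]) blast
  from KL_achieves_dual[OF this u(2)] obtain l where l: "0 \<le> l" "l \<le> 1"
    "\<forall>x\<in>set_pmf (emp h b). 0 < tilt \<mu> l x"
    and *: "\<forall>\<eta>. 0 \<le> \<eta> \<and> \<eta> < 1 \<longrightarrow> (\<exists>q. set_pmf q \<subseteq> set_pmf (emp h b) \<union> {1}
      \<and> (1 - \<eta>) * \<mu> + \<eta> \<le> mean q
      \<and> KL (emp h b) q \<le> ereal ((\<Sum>x\<in>set_pmf (emp h b). pmf (emp h b) x * ln (tilt \<mu> l x)) - ln (1 - \<eta>)))"
    by (elim exE conjE)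
  from *[rule_format, of 0] obtain q where q: "set_pmf q \<subseteq> set_pmf (emp h b) \<union> {1}" "\<mu> \<le> mean q"
    "KL (emp h b) q \<le> ereal ((\<Sum>x\<leftarrow>rewards h b. ln (tilt \<mu> l x)) / real (Npulls h b))"
    unfolding sum_emp[OF h(1)] by auto
  have "fexp (length h) < (\<Sum>x\<leftarrow>rewards h b. ln (tilt \<mu> l x))"
  proof (rule ccontr)
    assume "\<not> ?thesis"
    then have "(\<Sum>x\<leftarrow>rewards h b. ln (tilt \<mu> l x)) / real (Npulls h b) \<le> fexp (length h) / real (Npulls h b)"
      by (intro divide_right_mono) auto
    then have "KL (emp h b) q \<le> ereal (fexp (length h) / real (Npulls h b))"
      using q(3) order_trans by fastforce
    then have "mean q \<le> ucb h b" unfolding ucb_def using q(1)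
      by (intro cSup_upper bdd_aboveI[where M = 1])
        (auto intro: finsupp01_mean_le finsupp01_emp_subset[OF h])
    with q(2) u show False by simp
  qed
  with l show ?thesis unfolding set_emp[OF h(1)] by blast
qed

text \<open>In this range the tilt can vanish only at \<open>l = x = 1\<close>, and there it
  vanishes for every threshold.\<close>

lemma tilt_pos_mono:
  assumes "0 < tilt \<mu> l x" "m < 1" "0 \<le> l" "l \<le> 1" "x \<le> 1"
  shows "0 < tilt m l x"
proof (cases "l = 1")
  case True
  then show ?thesis using assms by (cases "x = 1") (auto simp: tilt_def)
next
  case False
  then show ?thesis using assms by (auto simp: tilt_def intro!: add_pos_nonneg)
qed

text \<open>The supremum in the index need not be known to be attained, so weak duality is applied
  at each \<open>m < \<mu>\<close> to a feasible \<open>q\<close> with \<open>mean q > m\<close>,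
  and \<open>m\<close> then tends to \<open>\<mu>\<close> from the left.\<close>

lemma le_ucb_imp_dual:
  assumes h: "rewards h b \<noteq> []" "set (rewards h b) \<subseteq> {0..1}" and u: "\<mu> \<le> ucb h b" "\<mu> < 1"
    and f: "0 \<le> fexp (length h)" and l: "0 \<le> l" "l \<le> 1"
    and pos: "\<And>x. x \<in> set (rewards h b) \<Longrightarrow> 0 < tilt \<mu> l x"
  shows "(\<Sum>x\<leftarrow>rewards h b. ln (tilt \<mu> l x)) \<le> fexp (length h)"
proof -
  define p where "p = emp h b"
  have set: "set_pmf p = set (rewards h b)" using h by (simp add: p_def set_emp)
  have N: "0 < Npulls h b" using h by (simp add: Npulls_rewards)
  define G where "G m = (\<Sum>x\<in>set_pmf p. pmf p x * ln (tilt m l x))" for m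
  have tp: "0 < tilt m l x" if "x \<in> set_pmf p" "m < 1" for x m
  proof -
    have x: "x \<in> set (rewards h b)" using that(1) set by simp
    then have "x \<le> 1" using h(2) by auto
    then show ?thesis by (rule tilt_pos_mono[OF pos[OF x] that(2) l])
  qed
  have Gle: "G m \<le> fexp (length h) / real (Npulls h b)" if m: "m < \<mu>" for m
  proof -
    let ?S = "{mean q | q. set_pmf q \<subseteq> set_pmf p \<union> {1} \<and> KL p q \<le> ereal (fexp (length h) / real (Npulls h b))}"
    \<comment> \<open>The empirical distribution itself is feasible, so \<open>Sup\<close> is taken
      over a nonempty set.\<close>
    have "KL p p = 0" by (auto simp: KL_def set_pmf_iff intro!: sum.neutral)
    moreover have "0 \<le> fexp (length h) / real (Npulls h b)" using f by simp
    ultimately have "mean p \<in> ?S" by (auto simp: zero_ereal_def)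
    then have "?S \<noteq> {}" by blast
    moreover have "m < Sup ?S" using m u by (simp add: ucb_def p_def)
    ultimately obtain q where q: "set_pmf q \<subseteq> set_pmf p \<union> {1}"
      "KL p q \<le> ereal (fexp (length h) / real (Npulls h b))" "m < mean q"
      using less_cSupD[of ?S m] by auto
    have "ereal (G m) \<le> KL p q" unfolding G_def
      using q m u l tp[of _ m] finsupp01_emp_subset[OF h, of q]
      by (intro dual_le_KL) (auto simp: p_def)
    with q(2) show ?thesis by (metis ereal_less_eq(3) order_trans)
  qed
  have "isCont G \<mu>" unfolding G_def tilt_def
  proof (intro continuous_intros)
    show "1 - l + l * ((1 - x) / (1 - \<mu>)) \<noteq> 0" if "x \<in> set_pmf p" for x
      using tp[OF that u(2)] by (simp add: tilt_def)
  qed (use u in auto)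
  then have "(G \<longlongrightarrow> G \<mu>) (at_left \<mu>)" by (simp add: isCont_def filterlim_at_split)
  then have "G \<mu> \<le> fexp (length h) / real (Npulls h b)"
  proof (rule tendsto_upperbound)
    show "\<forall>\<^sub>F m in at_left \<mu>. G m \<le> fexp (length h) / real (Npulls h b)"
      using Gle by (auto simp: eventually_at_left_field intro: exI[of _ "\<mu> - 1"])
  qed simp
  moreover have "G \<mu> = (\<Sum>x\<leftarrow>rewards h b. ln (tilt \<mu> l x)) / real (Npulls h b)"
    unfolding G_def p_def by (rule sum_emp[OF h(1)])
  ultimately show ?thesis using N by (simp add: divide_le_cancel)
qed

section \<open>Concentration\<close>

text \<open>Expanding \<open>\<Prod> (l a + (1 - l) b)\<close> over subsets \<open>B\<close> gives the weights \<open>l ^ |B| (1 - l) ^ (n - |B|)\<close>, which are at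
  most \<open>1 / (n choose |B|)\<close> uniformly in \<open>l\<close>; the \<open>2 ^ n\<close> bounds add up to only \<open>n + 1\<close>.\<close>

definition mixture :: "(real \<Rightarrow> real) \<Rightarrow> (real \<Rightarrow> real) \<Rightarrow> real list \<Rightarrow> real" where
  "mixture a b xs = (\<Sum>B\<in>Pow {..<length xs}.
     (\<Prod>i<length xs. (if i \<in> B then a else b) (xs ! i)) / real (length xs choose card B))"

text \<open>The left side times the binomial coefficient is one term in the expansion of
  \<open>(l + (1 - l)) ^ n = 1\<close>.\<close>

lemma choose_weight_le_1:
  assumes "0 \<le> l" "l \<le> (1::real)" "k \<le> n"
  shows "l ^ k * (1 - l) ^ (n - k) \<le> 1 / real (n choose k)"
proof -
  have "real (n choose k) * l ^ k * (1 - l) ^ (n - k) \<le> (\<Sum>k\<le>n. real (n choose k) * l ^ k * (1 - l) ^ (n - k))"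
    using assms by (intro member_le_sum[where f = "\<lambda>k. real (n choose k) * l ^ k * (1 - l) ^ (n - k)"]) auto
  also have "\<dots> = 1" using binomial_ring[of l "1 - l" n] by simp
  finally show ?thesis using assms by (simp add: field_simps)
qed

lemma prod_le_mixture:
  assumes l: "0 \<le> l" "l \<le> 1" and ab: "\<And>x. x \<in> set xs \<Longrightarrow> 0 \<le> a x" "\<And>x. x \<in> set xs \<Longrightarrow> 0 \<le> b x"
  shows "(\<Prod>i<length xs. l * a (xs ! i) + (1 - l) * b (xs ! i)) \<le> mixture a b xs"
proof -
  let ?n = "length xs"
  have "(\<Prod>i<?n. l * a (xs ! i) + (1 - l) * b (xs ! i))
     = (\<Sum>B\<in>Pow {..<?n}. (\<Prod>i\<in>B. l * a (xs ! i)) * (\<Prod>i\<in>{..<?n} - B. (1 - l) * b (xs ! i)))"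
    by (rule prod_add) simp
  also have "\<dots> \<le> mixture a b xs" unfolding mixture_def
  proof (intro sum_mono)
    fix B assume "B \<in> Pow {..<?n}"
    then have B: "B \<subseteq> {..<?n}" "finite B" using finite_subset by auto
    have c: "card B \<le> ?n" using card_mono[OF _ B(1)] by simp
    have 1: "(\<Prod>i\<in>B. a (xs ! i)) * (\<Prod>i\<in>{..<?n} - B. b (xs ! i)) = (\<Prod>i<?n. (if i \<in> B then a else b) (xs ! i))"
      (is "?L = ?R")
    proof -
      have "?R = (\<Prod>i\<in>{..<?n} - B. (if i \<in> B then a else b) (xs ! i)) * (\<Prod>i\<in>B. (if i \<in> B then a else b) (xs ! i))"
        using B by (intro prod.subset_diff) auto
      also have "\<dots> = (\<Prod>i\<in>{..<?n} - B. b (xs ! i)) * (\<Prod>i\<in>B. a (xs ! i))"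
        by (intro arg_cong2[where f = "(*)"] prod.cong) auto
      finally show ?thesis by simp
    qed
    have "0 \<le> ?R" using ab by (intro prod_nonneg) auto
    then have "l ^ card B * (1 - l) ^ (?n - card B) * ?R \<le> 1 / real (?n choose card B) * ?R"
      using choose_weight_le_1[OF l c] by (intro mult_right_mono) auto
    moreover have "(\<Prod>i\<in>B. l * a (xs ! i)) * (\<Prod>i\<in>{..<?n} - B. (1 - l) * b (xs ! i))
        = l ^ card B * (1 - l) ^ (?n - card B) * ?R"
      using B unfolding 1[symmetric] prod.distrib by (simp add: card_Diff_subset)
    ultimately show "(\<Prod>i\<in>B. l * a (xs ! i)) * (\<Prod>i\<in>{..<?n} - B. (1 - l) * b (xs ! i))
        \<le> ?R / real (?n choose card B)" by simp
  qed
  finally show ?thesis .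
qed

lemma sum_Pow_inverse_choose: "(\<Sum>B\<in>Pow {..<n}. 1 / real (n choose card B)) = real (n + 1)"
proof -
  \<comment> \<open>Grouped by cardinality, the subsets of each of the \<open>n + 1\<close> sizes
    contribute exactly 1.\<close>
  have "(\<Sum>B\<in>Pow {..<n}. 1 / real (n choose card B))
    = (\<Sum>k\<in>{..n}. \<Sum>B\<in>{B. B \<in> Pow {..<n} \<and> card B = k}. 1 / real (n choose card B))"
    using card_mono[of "{..<n}"] by (intro sum.group[symmetric]) auto
  also have "\<dots> = (\<Sum>k\<in>{..n}. 1)"
  proof (intro sum.cong refl)
    fix k assume "k \<in> {..n}"
    then show "(\<Sum>B\<in>{B. B \<in> Pow {..<n} \<and> card B = k}. 1 / real (n choose card B)) = 1"
      using n_subsets[of "{..<n}" k] by simp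
  qed
  finally show ?thesis by simp
qed

text \<open>By independence each product in the mixture has expectation at most
  \<open>r ^ n\<close>; the weights sum to \<open>n + 1\<close>, which is the whole price for
  uniformity in \<open>l\<close>.\<close>

lemma E_mixture_le:
  assumes p: "finite (set_pmf p)" and a: "\<And>x. x \<in> set_pmf p \<Longrightarrow> 0 \<le> a x" "E p a \<le> r"
    and b: "\<And>x. x \<in> set_pmf p \<Longrightarrow> 0 \<le> b x" "E p b \<le> r"
  shows "E (replicate_pmf n p) (mixture a b) \<le> real (n + 1) * r ^ n"
proof -
  have fin: "finite (set_pmf (replicate_pmf n p))" using p by (rule set_replicate_pmf_finite)
  have "E (replicate_pmf n p) (mixture a b)
    = E (replicate_pmf n p) (\<lambda>xs. \<Sum>B\<in>Pow {..<n}. (\<Prod>i<n. (if i \<in> B then a else b) (xs ! i)) / real (n choose card B))"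
    by (intro E_cong) (auto simp: mixture_def set_replicate_pmf)
  also have "\<dots> = (\<Sum>B\<in>Pow {..<n}. (\<Prod>i<n. E p (if i \<in> B then a else b)) / real (n choose card B))"
    using fin by (simp add: E_sum E_replicate_prod[OF p, where \<phi> = "\<lambda>i. if i \<in> B then a else b" for B])
  also have "\<dots> \<le> (\<Sum>B\<in>Pow {..<n}. r ^ n * (1 / real (n choose card B)))"
  proof (intro sum_mono)
    fix B
    have "0 \<le> E p a" "0 \<le> E p b" using a b by (auto intro!: integral_nonneg_AE simp: AE_measure_pmf_iff)
    then have "(\<Prod>i<n. E p (if i \<in> B then a else b)) \<le> (\<Prod>i<n. r)"
      using a b by (intro prod_mono) auto
    then show "(\<Prod>i<n. E p (if i \<in> B then a else b)) / real (n choose card B)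
        \<le> r ^ n * (1 / real (n choose card B))"
      by (simp add: divide_right_mono)
  qed
  also have "\<dots> = real (n + 1) * r ^ n"
    unfolding sum_distrib_left[symmetric] sum_Pow_inverse_choose by simp
  finally show ?thesis .
qed

section \<open>Exponential moment bounds\<close>

lemma exp_le_quadratic:
  fixes z :: real
  assumes "z \<le> 1"
  shows "exp z \<le> 1 + z + z\<^sup>2"
proof (cases "0 \<le> z")
  case True
  then show ?thesis using assms exp_bound by blast
next
  case False
  have "1 - z + z\<^sup>2 / 2 \<le> exp (- z)" using exp_lower_Taylor_quadratic[of "- z"] False by simp
  moreover have "0 < 1 - z + z\<^sup>2 / 2" using False by (intro add_pos_nonneg) auto
  ultimately have "exp z \<le> 1 / (1 - z + z\<^sup>2 / 2)"
    by (simp add: exp_minus field_simps)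
  also have "\<dots> \<le> 1 + z + z\<^sup>2"
  proof -
    have "0 \<le> z\<^sup>2 * (1 - z + z\<^sup>2) / 2" using False by (intro divide_nonneg_nonneg mult_nonneg_nonneg) auto
    also have "z\<^sup>2 * (1 - z + z\<^sup>2) / 2 = (1 + z + z\<^sup>2) * (1 - z + z\<^sup>2 / 2) - 1"
      by (simp add: power2_eq_square field_simps)
    finally show ?thesis using \<open>0 < 1 - z + z\<^sup>2 / 2\<close> by (simp add: divide_le_eq)
  qed
  finally show ?thesis .
qed

text \<open>A Chernoff bound with the second moment estimated by \<open>B\<^sup>2\<close>. The
  choice \<open>s = d / (2 * B\<^sup>2)\<close> minimises the right side, with value
  \<open>1 - d\<^sup>2 / (4 * B\<^sup>2)\<close>.\<close>

lemma mgf_le: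
  assumes p: "finite (set_pmf p)" and Y: "\<And>x. x \<in> set_pmf p \<Longrightarrow> \<bar>Y x\<bar> \<le> B"
    and d: "d \<le> E p Y" and s: "0 \<le> s" "s * B \<le> 1"
  shows "E p (\<lambda>x. exp (- s * Y x)) \<le> 1 - s * d + s\<^sup>2 * B\<^sup>2"
proof -
  have "E p (\<lambda>x. exp (- s * Y x)) \<le> E p (\<lambda>x. (1 + s\<^sup>2 * B\<^sup>2) + (- s) * Y x)"
  proof (rule E_mono[OF p])
    fix x assume x: "x \<in> set_pmf p"
    have "\<bar>s * Y x\<bar> \<le> s * B" using Y[OF x] s by (simp add: abs_mult mult_left_mono)
    then have le: "- s * Y x \<le> 1" "(s * Y x)\<^sup>2 \<le> (s * B)\<^sup>2"
      using s by (auto simp: abs_le_square_iff[symmetric])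
    have "exp (- s * Y x) \<le> 1 + (- s * Y x) + (- s * Y x)\<^sup>2" by (rule exp_le_quadratic[OF le(1)])
    then show "exp (- s * Y x) \<le> (1 + s\<^sup>2 * B\<^sup>2) + (- s) * Y x" using le(2) by (simp add: power_mult_distrib)
  qed
  also have "\<dots> = (1 + s\<^sup>2 * B\<^sup>2) - s * E p Y"
    using p by (subst E_add) auto
  also have "\<dots> \<le> 1 - s * d + s\<^sup>2 * B\<^sup>2" using mult_left_mono[OF d s(1)] by simp
  finally show ?thesis .
qed

lemma exp_sum_list_ln:
  "(\<And>x. x \<in> set xs \<Longrightarrow> (0::real) < g x) \<Longrightarrow> exp (\<Sum>x\<leftarrow>xs. ln (g x)) = (\<Prod>i<length xs. g (xs ! i))"
  by (induction xs) (auto simp: exp_add prod.lessThan_Suc_shift simp del: prod.lessThan_Suc)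

text \<open>The factor \<open>exp (s (\<mu> - x))\<close> turns the gap between \<open>\<mu>\<close> and the true mean into exponential
  decay in the sample size, and it does not decrease the likelihood ratio on the event of interest
  because there the empirical mean is below \<open>\<mu>\<close>.\<close>

lemma dual_imp_mixture_ge:
  assumes l: "0 \<le> l" "l \<le> 1" and \<mu>: "\<mu> < 1" and xs: "set xs \<subseteq> {0..1}"
    and pos: "\<And>x. x \<in> set xs \<Longrightarrow> 0 < tilt \<mu> l x"
    and f: "0 \<le> f" "f < (\<Sum>x\<leftarrow>xs. ln (tilt \<mu> l x))" and s: "0 \<le> s"
  shows "exp f \<le> mixture (\<lambda>x. (1 - x) / (1 - \<mu>) * exp (s * (\<mu> - x))) (\<lambda>x. exp (s * (\<mu> - x))) xs"
proof -
  \<comment> \<open>The log-ratio is at most a nonnegative multiple of the sum of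
    \<open>\<mu> - x\<close>, so its positivity forces the empirical mean below
    \<open>\<mu>\<close>.\<close>
  have "(\<Sum>x\<leftarrow>xs. ln (tilt \<mu> l x)) \<le> (\<Sum>x\<leftarrow>xs. l / (1 - \<mu>) * (\<mu> - x))"
  proof (rule sum_list_mono)
    fix x assume "x \<in> set xs"
    then have "ln (tilt \<mu> l x) \<le> tilt \<mu> l x - 1" using pos by (intro ln_le_minus_one) auto
    also have "\<dots> = l / (1 - \<mu>) * (\<mu> - x)" using \<mu> by (simp add: tilt_def field_simps)
    finally show "ln (tilt \<mu> l x) \<le> l / (1 - \<mu>) * (\<mu> - x)" .
  qed
  also have "\<dots> = l / (1 - \<mu>) * (\<Sum>x\<leftarrow>xs. \<mu> - x)" by (rule sum_list_const_mult)
  finally have "0 < l / (1 - \<mu>) * (\<Sum>x\<leftarrow>xs. \<mu> - x)" using f by linarith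
  moreover have "0 \<le> l / (1 - \<mu>)" using l \<mu> by simp
  ultimately have "0 < (\<Sum>x\<leftarrow>xs. \<mu> - x)" using mult_nonneg_nonpos not_less by blast
  then have "0 \<le> s * (\<Sum>x\<leftarrow>xs. \<mu> - x)" using s by simp
  also have "s * (\<Sum>x\<leftarrow>xs. \<mu> - x) = (\<Sum>x\<leftarrow>xs. s * (\<mu> - x))" by (rule sum_list_const_mult[symmetric])
  finally have "exp f \<le> exp ((\<Sum>x\<leftarrow>xs. ln (tilt \<mu> l x)) + (\<Sum>x\<leftarrow>xs. s * (\<mu> - x)))" using f by simp
  also have "(\<Sum>x\<leftarrow>xs. ln (tilt \<mu> l x)) + (\<Sum>x\<leftarrow>xs. s * (\<mu> - x))
      = (\<Sum>x\<leftarrow>xs. ln (tilt \<mu> l x) + s * (\<mu> - x))" by (simp add: sum_list_addf)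
  also have "\<dots> = (\<Sum>x\<leftarrow>xs. ln (tilt \<mu> l x * exp (s * (\<mu> - x))))"
  proof (intro arg_cong[where f = sum_list] map_cong refl)
    fix x assume "x \<in> set xs"
    then show "ln (tilt \<mu> l x) + s * (\<mu> - x) = ln (tilt \<mu> l x * exp (s * (\<mu> - x)))"
      using pos[of x] by (simp add: ln_mult)
  qed
  also have "exp \<dots> = (\<Prod>i<length xs. tilt \<mu> l (xs ! i) * exp (s * (\<mu> - xs ! i)))"
    using pos by (intro exp_sum_list_ln) auto
  \<comment> \<open>Each factor is a convex combination with weight \<open>l\<close> of two
    functions independent of \<open>l\<close>, the form that \<open>prod_le_mixture\<close>
    handles.\<close>
  also have "\<dots> = (\<Prod>i<length xs. l * ((1 - xs ! i) / (1 - \<mu>) * exp (s * (\<mu> - xs ! i)))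
      + (1 - l) * exp (s * (\<mu> - xs ! i)))"
    by (intro prod.cong) (auto simp: tilt_def algebra_simps)
  also have "\<dots> \<le> mixture (\<lambda>x. (1 - x) / (1 - \<mu>) * exp (s * (\<mu> - x))) (\<lambda>x. exp (s * (\<mu> - x))) xs"
    using xs \<mu> by (intro prod_le_mixture l) auto
  finally show ?thesis .
qed

text \<open>These are the two components of the mixture, with gap
  \<open>e = mean p * \<epsilon>\<close>. The first is \<open>mgf_le\<close> at the optimal
  \<open>s = e / 2\<close>. In the second the density already has mean at most \<open>1 - e\<close>,
  and \<open>exp s <= 1 / (1 - s)\<close> loses only half of that gain.\<close>

lemma tilted_mgf_le:
  assumes p: "finsupp01 p" and \<mu>: "0 < mean p" "mean p < 1" and \<epsilon>: "0 < \<epsilon>" "\<epsilon> < 1"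
  defines "m \<equiv> mean p * (1 - \<epsilon>)" and "s \<equiv> mean p * \<epsilon> / 2" and "\<rho> \<equiv> (mean p * \<epsilon>)\<^sup>2 / 4"
  shows "E p (\<lambda>x. exp (s * (m - x))) \<le> 1 - \<rho>"
    and "E p (\<lambda>x. (1 - x) / (1 - m) * exp (s * (m - x))) \<le> 1 - \<rho>"
proof -
  have fin: "finite (set_pmf p)" and p01: "\<And>x. x \<in> set_pmf p \<Longrightarrow> 0 \<le> x \<and> x \<le> 1"
    using p by (auto simp: finsupp01_def)
  define e where "e = mean p * \<epsilon>"
  have e: "0 < e" "e < mean p" using \<mu> \<epsilon> by (auto simp: e_def)
  have m: "m = mean p - e" by (simp add: m_def e_def algebra_simps)
  have s: "s = e / 2" by (simp add: s_def e_def)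
  have "E p (\<lambda>x. x - m) = E p (\<lambda>x. x + - m)" by simp
  also have "\<dots> = mean p - m" using fin by (subst E_add) (auto simp: mean_def)
  finally have "E p (\<lambda>x. x - m) = e" by (simp add: m)
  then have "E p (\<lambda>x. exp (- s * (x - m))) \<le> 1 - s * e + s\<^sup>2 * 1\<^sup>2"
    using fin e \<mu> p01 m by (intro mgf_le) (force simp: s)+
  moreover have "- s * (x - m) = s * (m - x)" for x by (simp add: algebra_simps)
  moreover have "1 - s * e + s\<^sup>2 * 1\<^sup>2 = 1 - \<rho>"
    by (simp add: s \<rho>_def e_def[symmetric] power2_eq_square)
  ultimately show "E p (\<lambda>x. exp (s * (m - x))) \<le> 1 - \<rho>" by simp
  have "E p (\<lambda>x. (1 - x) / (1 - m) * exp (s * (m - x))) \<le> E p (\<lambda>x. exp s / (1 - m) * (1 + (-1) * x))"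
  proof (rule E_mono[OF fin])
    fix x assume x: "x \<in> set_pmf p"
    have "s * (m - x) \<le> s * 1" using p01[OF x] m e \<mu> by (intro mult_left_mono) (auto simp: s)
    then have "exp (s * (m - x)) * ((1 - x) / (1 - m)) \<le> exp s * ((1 - x) / (1 - m))"
      using p01[OF x] m e \<mu> by (intro mult_right_mono) auto
    then show "(1 - x) / (1 - m) * exp (s * (m - x)) \<le> exp s / (1 - m) * (1 + (-1) * x)"
      by (simp add: mult.commute)
  qed
  also have "\<dots> = exp s / (1 - m) * (1 - mean p)"
    using fin by (subst Bochner_Integration.integral_mult_right_zero, subst E_add) (auto simp: mean_def)
  also have "\<dots> = exp s * ((1 - mean p) / (1 - m))" by simp
  also have "\<dots> \<le> (1 / (1 - s)) * (1 - e)"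
  proof (intro mult_mono)
    have "1 - s \<le> exp (- s)" using exp_ge_add_one_self[of "- s"] by simp
    then show "exp s \<le> 1 / (1 - s)" using e \<mu> by (simp add: exp_minus field_simps s)
    have "(1 - e) * (1 - m) = 1 - mean p + e * (mean p - e)" by (simp add: m algebra_simps)
    also have "\<dots> \<ge> 1 - mean p" using e by simp
    finally show "(1 - mean p) / (1 - m) \<le> 1 - e" using e \<mu> m by (simp add: divide_le_eq)
  qed (use e \<mu> m in \<open>auto simp: s\<close>)
  also have "\<dots> \<le> 1 - e / 2"
  proof -
    have "(1 - e / 2) * (1 - s) = 1 - e + (e / 2)\<^sup>2" by (simp add: s power2_eq_square field_simps)
    then have "1 - e \<le> (1 - e / 2) * (1 - s)" by simp
    then show ?thesis using e \<mu> by (simp add: s divide_le_eq)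
  qed
  also have "\<dots> \<le> 1 - \<rho>"
  proof -
    have "e * e \<le> e * 1" using e \<mu> by (intro mult_left_mono) auto
    then show ?thesis using e by (simp add: \<rho>_def e_def[symmetric] power2_eq_square)
  qed
  finally show "E p (\<lambda>x. (1 - x) / (1 - m) * exp (s * (m - x))) \<le> 1 - \<rho>" .
qed

text \<open>At \<open>t = 2\<close> the term \<open>ln (ln t)\<close> is negative, so positivity is
  read off from \<open>t * ln t >= 4/3 > 1\<close>.\<close>

lemma fexp_pos: "2 \<le> t \<Longrightarrow> 0 < fexp t"
  and exp_fexp: "2 \<le> t \<Longrightarrow> exp (fexp t) = real t * ln (real t)"
proof -
  assume t: "2 \<le> t"
  have "2/3 \<le> ln (2::real)" by (rule ln2_ge_two_thirds)
  also have "ln 2 \<le> ln (real t)" using t by simp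
  finally have ln: "2/3 \<le> ln (real t)" .
  then show "exp (fexp t) = real t * ln (real t)" using t by (simp add: fexp_def exp_add)
  moreover have "2 * (2/3) \<le> real t * ln (real t)" using t ln by (intro mult_mono) auto
  ultimately have "exp 0 < exp (fexp t)" by simp
  then show "0 < fexp t" by (simp only: exp_less_cancel_iff)
qed

lemma fexp_mono: "2 \<le> t \<Longrightarrow> t \<le> t' \<Longrightarrow> fexp t \<le> fexp t'"
  unfolding fexp_def by (intro add_mono) auto

text \<open>Using \<open>ln x <= x - 1\<close> twice, the term at \<open>t\<close> is at most the
  increment of \<open>ln (ln t)\<close> from \<open>t - 1\<close>. This requires
  \<open>t >= 3\<close>; the term at 2 is at most \<open>3/4\<close> and \<open>- ln (ln 2)\<close>
  at most \<open>1/2\<close>, both from \<open>ln 2 >= 2/3\<close>.\<close>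

lemma sum_inverse_t_ln_t:
  assumes "3 \<le> T"
  shows "(\<Sum>t=2..<T. 1 / (real t * ln (real t))) \<le> ln (ln (real T)) + 2"
proof -
  have "(\<Sum>t=2..<T. 1 / (real t * ln (real t))) \<le> ln (ln (real (T - 1))) - ln (ln 2) + 3/4"
    using assms
  proof (induction T rule: dec_induct)
    case base
    have "1 / (2 * ln 2) \<le> (3/4::real)" using ln2_ge_two_thirds by (simp add: field_simps)
    moreover have "{2..<3::nat} = {2}" by auto
    ultimately show ?case by simp
  next
    case (step n)
    define a where "a = ln (real (n - 1))"
    define b where "b = ln (real n)"
    have a: "0 < a" and b: "0 < b" using step(1) by (auto simp: a_def b_def)
    have "ln (real (n - 1) / real n) \<le> real (n - 1) / real n - 1"
      using step(1) by (intro ln_le_minus_one) auto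
    then have 1: "1 / real n \<le> b - a" using step(1) by (simp add: a_def b_def ln_div of_nat_diff field_simps)
    have "ln (a / b) \<le> a / b - 1" using a b by (intro ln_le_minus_one) auto
    then have "(b - a) / b \<le> ln b - ln a" using a b by (simp add: ln_div diff_divide_distrib)
    moreover have "1 / real n / b \<le> (b - a) / b" using 1 b by (intro divide_right_mono) auto
    ultimately have "1 / (real n * b) \<le> ln b - ln a" by simp
    then show ?case using step by (simp add: a_def b_def)
  qed
  moreover have "ln (ln (real (T - 1))) \<le> ln (ln (real T))" using assms by simp
  moreover have "- ln (ln 2) \<le> (1/2::real)"
  proof -
    have "ln (1 / ln 2) \<le> 1 / ln 2 - (1::real)" by (intro ln_le_minus_one) auto
    moreover have "1 / ln 2 \<le> (3/2::real)" using ln2_ge_two_thirds by (simp add: field_simps)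
    ultimately show ?thesis by (simp add: ln_div)
  qed
  ultimately show ?thesis by linarith
qed

section \<open>Regret\<close>

context bandit
begin

text \<open>The number of pulls is random, so a union bound runs over its values \<open>n\<close>;
  for each, Markov's inequality for the mixture gives
  \<open>(n + 1) * (1 - \<rho>) ^ n / exp (fexp t)\<close>.\<close>

lemma prob_ucb_less:
  assumes b: "b < K" "finsupp01 (nu b)" "0 < mean (nu b)" "mean (nu b) < 1"
    and \<epsilon>: "0 < \<epsilon>" "\<epsilon> < 1" and t: "K \<le> t" "2 \<le> t"
  shows "E (H t) (\<lambda>h. of_bool (ucb h b < mean (nu b) * (1 - \<epsilon>)))
    \<le> 16 / (mean (nu b) * \<epsilon>) ^ 4 * (1 / (real t * ln (real t)))"
proof -
  define m where "m = mean (nu b) * (1 - \<epsilon>)"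
  define s where "s = mean (nu b) * \<epsilon> / 2"
  define \<rho> where "\<rho> = (mean (nu b) * \<epsilon>)\<^sup>2 / 4"
  define W where "W = mixture (\<lambda>x. (1 - x) / (1 - m) * exp (s * (m - x))) (\<lambda>x. exp (s * (m - x)))"
  have "mean (nu b) * \<epsilon> < 1 * 1" using b \<epsilon> by (intro mult_strict_mono) auto
  then have e: "0 < mean (nu b) * \<epsilon>" "mean (nu b) * \<epsilon> < 1" using b \<epsilon> by auto
  then have "(mean (nu b) * \<epsilon>)\<^sup>2 < 1" by (simp add: power_less_one_iff abs_square_less_1)
  then have \<rho>: "0 < \<rho>" "\<rho> < 1" using e by (auto simp: \<rho>_def)
  have m1: "m < 1" using b e by (simp add: m_def algebra_simps)
  have s0: "0 \<le> s" using e by (simp add: s_def)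
  have fin: "finite (set_pmf (nu b))" and sub: "set_pmf (nu b) \<subseteq> {0..1}"
    using b(2) by (auto simp: finsupp01_def)
  have W0: "0 \<le> W xs" if "set xs \<subseteq> {0..1}" for xs
  proof -
    have "0 \<le> 1 - xs ! i" if "i < length xs" for i
      using nth_mem[OF that] \<open>set xs \<subseteq> {0..1}\<close> by auto
    then show ?thesis unfolding W_def mixture_def using m1
      by (intro sum_nonneg divide_nonneg_nonneg prod_nonneg) auto
  qed
  \<comment> \<open>\<open>E_take_rewards_le\<close> asks for nonnegativity on all lists, whereas
    \<open>W\<close> is known to be nonnegative only for rewards in the unit interval; there the
    absolute value changes nothing.\<close>
  define F where "F xs = \<bar>W xs\<bar> / exp (fexp t)" for xs
  have "E (H t) (\<lambda>h. of_bool (ucb h b < m))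
     \<le> E (H t) (\<lambda>h. \<Sum>n\<le>t. of_bool (n \<le> Npulls h b) * F (take n (rewards h b)))"
  proof (rule E_mono[OF finite_H])
    fix h assume h: "h \<in> set_pmf (H t)"
    have N: "0 < Npulls h b" using Npulls_pos[OF h b(1)] b t by simp
    then have ne: "rewards h b \<noteq> []" by (simp add: Npulls_rewards)
    have r01: "set (rewards h b) \<subseteq> {0..1}" using rewards_H[OF h] sub by blast
    have len: "length h = t" using length_H[OF h] .
    have "Npulls h b \<le> t" using len by (simp add: Npulls_def length_filter_le[THEN order_trans])
    show "of_bool (ucb h b < m) \<le> (\<Sum>n\<le>t. of_bool (n \<le> Npulls h b) * F (take n (rewards h b)))"
    proof (cases "ucb h b < m")
      case True
      from ucb_less_imp_dual[OF ne r01 True m1] obtain l where l: "0 \<le> l" "l \<le> 1"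
        "\<And>x. x \<in> set (rewards h b) \<Longrightarrow> 0 < tilt m l x" "fexp t < (\<Sum>x\<leftarrow>rewards h b. ln (tilt m l x))"
        unfolding len by blast
      have "exp (fexp t) \<le> W (rewards h b)"
        unfolding W_def using fexp_pos[OF t(2)]
        by (intro dual_imp_mixture_ge[of l] l r01 m1 s0) auto
      then have "1 \<le> F (rewards h b)" by (simp add: F_def)
      also have "\<dots> = of_bool (Npulls h b \<le> Npulls h b) * F (take (Npulls h b) (rewards h b))"
        by (simp add: Npulls_rewards)
      also have "\<dots> \<le> (\<Sum>n\<le>t. of_bool (n \<le> Npulls h b) * F (take n (rewards h b)))"
        using \<open>Npulls h b \<le> t\<close>
        by (intro member_le_sum[where f = "\<lambda>n. of_bool (n \<le> Npulls h b) * F (take n (rewards h b))"])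
          (auto simp: F_def)
      finally show ?thesis using True by simp
    qed (auto simp: F_def intro!: sum_nonneg)
  qed
  also have "\<dots> = (\<Sum>n\<le>t. E (H t) (\<lambda>h. of_bool (n \<le> Npulls h b) * F (take n (rewards h b))))"
    by (rule E_sum[OF finite_H])
  also have "\<dots> \<le> (\<Sum>n\<le>t. real (Suc n) * (1 - \<rho>) ^ n / exp (fexp t))"
  proof (rule sum_mono)
    fix n
    have "E (H t) (\<lambda>h. of_bool (n \<le> Npulls h b) * F (take n (rewards h b))) \<le> E (replicate_pmf n (nu b)) F"
      by (rule E_take_rewards_le[OF b(1)]) (simp add: F_def)
    also have "\<dots> = E (replicate_pmf n (nu b)) W / exp (fexp t)"
    proof -
      have "E (replicate_pmf n (nu b)) F = E (replicate_pmf n (nu b)) (\<lambda>xs. W xs / exp (fexp t))"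
      proof (rule E_cong)
        fix xs assume "xs \<in> set_pmf (replicate_pmf n (nu b))"
        then have "set xs \<subseteq> {0..1}" using sub by (auto simp: set_replicate_pmf)
        then show "F xs = W xs / exp (fexp t)" using W0 by (simp add: F_def)
      qed
      then show ?thesis by simp
    qed
    also have "\<dots> \<le> real (n + 1) * (1 - \<rho>) ^ n / exp (fexp t)"
      unfolding W_def
      using tilted_mgf_le[OF b(2,3,4) \<epsilon>] sub m1
      by (intro divide_right_mono E_mixture_le fin) (auto simp: m_def s_def \<rho>_def)
    finally show "E (H t) (\<lambda>h. of_bool (n \<le> Npulls h b) * F (take n (rewards h b)))
      \<le> real (Suc n) * (1 - \<rho>) ^ n / exp (fexp t)" by simp
  qed
  also have "\<dots> = (\<Sum>n\<le>t. real (Suc n) * (1 - \<rho>) ^ n) / exp (fexp t)"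
    by (simp only: sum_divide_distrib)
  also have "\<dots> \<le> 1 / \<rho>\<^sup>2 / exp (fexp t)"
  proof (rule divide_right_mono)
    \<comment> \<open>The differentiated geometric series.\<close>
    have "(\<lambda>n. real (Suc n) * (1 - \<rho>) ^ n) sums (1 / (1 - (1 - \<rho>))\<^sup>2)"
      using \<rho> by (intro geometric_deriv_sums) auto
    then show "(\<Sum>n\<le>t. real (Suc n) * (1 - \<rho>) ^ n) \<le> 1 / \<rho>\<^sup>2"
      using \<rho> sum_le_suminf[of "\<lambda>n. real (Suc n) * (1 - \<rho>) ^ n" "{..t}"]
      by (simp add: sums_iff)
  qed simp
  also have "\<dots> = 16 / (mean (nu b) * \<epsilon>) ^ 4 * (1 / (real t * ln (real t)))"
  proof -
    have eq: "(mean (nu b) * \<epsilon>) ^ 4 = 16 * \<rho>\<^sup>2"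
      unfolding \<rho>_def power_divide power_mult[symmetric] by simp
    show ?thesis unfolding exp_fexp[OF t(2)] eq by simp
  qed
  finally show ?thesis by (simp add: m_def)
qed

text \<open>Pulls are indexed by the pull count \<open>n\<close> instead of the round. Counts with
  \<open>n * \<tau> < fexp T\<close> are bounded by 1 each; beyond that, Chernoff gives
  \<open>q ^ n\<close>.\<close>

lemma sum_prob_le_ucb:
  assumes a: "a < K" "finsupp01 (nu a)" and m: "m < 1" and l: "0 \<le> l" "l \<le> 1"
    and pos: "\<And>x. x \<in> set_pmf (nu a) \<Longrightarrow> 0 < tilt m l x"
    and K: "2 \<le> K" and T: "2 \<le> T" and s: "0 \<le> s" and \<tau>: "0 < \<tau>"
    and mgf: "E (nu a) (\<lambda>x. exp (s * (\<tau> - ln (tilt m l x)))) \<le> q" and q: "q < 1"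
  shows "(\<Sum>t=K..<T. E (H t) (\<lambda>h. of_bool (pol h = a \<and> m \<le> ucb h a))) \<le> fexp T / \<tau> + 1 / (1 - q)"
proof -
  \<comment> \<open>The level \<open>fexp t\<close> is raised to \<open>fexp T\<close>, so that the
    event depends on the rewards and not on the round, as the telescoping requires.\<close>
  define Q where "Q xs \<longleftrightarrow> (\<Sum>x\<leftarrow>xs. ln (tilt m l x)) \<le> fexp T" for xs
  define g where "g x = exp (s * (\<tau> - ln (tilt m l x)))" for x
  have fin: "finite (set_pmf (nu a))" using a fin by blast
  have f0: "0 < fexp T" using T by (rule fexp_pos)
  have q0: "0 \<le> q" using mgf by (rule order_trans[rotated]) (auto intro!: integral_nonneg_AE)
  have "(\<Sum>t=K..<T. E (H t) (\<lambda>h. of_bool (pol h = a \<and> m \<le> ucb h a)))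
    \<le> (\<Sum>t=K..<T. E (H t) (\<lambda>h. \<Sum>n=1..T. of_bool (pol h = a \<and> Npulls h a = n \<and> Q (rewards h a))))"
  proof (intro sum_mono E_mono finite_H)
    fix t h assume t: "t \<in> {K..<T}" and h: "h \<in> set_pmf (H t)"
    have N: "0 < Npulls h a" using Npulls_pos[OF h a(1)] a t by simp
    then have ne: "rewards h a \<noteq> []" by (simp add: Npulls_rewards)
    have sub: "set (rewards h a) \<subseteq> set_pmf (nu a)" by (rule rewards_H[OF h])
    have len: "length h = t" using length_H[OF h] .
    have NT: "Npulls h a \<le> T"
      using len t length_filter_le[of "\<lambda>p. fst p = a" h] by (simp add: Npulls_def)
    show "of_bool (pol h = a \<and> m \<le> ucb h a)
      \<le> (\<Sum>n=1..T. of_bool (pol h = a \<and> Npulls h a = n \<and> Q (rewards h a)) :: real)"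
    proof (cases "pol h = a \<and> m \<le> ucb h a")
      case True
      have "(\<Sum>x\<leftarrow>rewards h a. ln (tilt m l x)) \<le> fexp t"
        using True sub a(2) fexp_pos[of t] K t pos m l ne unfolding len[symmetric]
        by (intro le_ucb_imp_dual) (auto simp: finsupp01_def)
      also have "\<dots> \<le> fexp T" using K t by (intro fexp_mono) auto
      finally have "Q (rewards h a)" by (simp add: Q_def)
      then have "1 = (of_bool (pol h = a \<and> Npulls h a = Npulls h a \<and> Q (rewards h a)) :: real)"
        using True by simp
      also have "\<dots> \<le> (\<Sum>n=1..T. of_bool (pol h = a \<and> Npulls h a = n \<and> Q (rewards h a)))"
        using N NT
        by (intro member_le_sum[where f = "\<lambda>n. of_bool (pol h = a \<and> Npulls h a = n \<and> Q (rewards h a))"]) auto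
      finally show ?thesis using True by simp
    qed (auto intro!: sum_nonneg)
  qed
  also have "\<dots> = (\<Sum>n=1..T. \<Sum>t=K..<T. E (H t) (\<lambda>h. of_bool (pol h = a \<and> Npulls h a = n \<and> Q (rewards h a))))"
    by (simp only: E_sum[OF finite_H]) (rule sum.swap)
  also have "\<dots> \<le> (\<Sum>n=1..T. of_bool (real n * \<tau> < fexp T) + q ^ n)"
  proof (rule sum_mono)
    fix n
    have "(\<Sum>t=K..<T. E (H t) (\<lambda>h. of_bool (pol h = a \<and> Npulls h a = n \<and> Q (rewards h a))))
      \<le> (\<Sum>t<T. E (H t) (\<lambda>h. of_bool (pol h = a \<and> Npulls h a = n \<and> Q (rewards h a))))"
      by (intro sum_mono2) (auto intro!: integral_nonneg_AE)
    also have "\<dots> = E (H T) (\<lambda>h. of_bool (n < Npulls h a \<and> Q (take n (rewards h a))))"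
      by (rule sum_pulls_telescope)
    also have "\<dots> \<le> of_bool (real n * \<tau> < fexp T) + q ^ n"
    proof (cases "real n * \<tau> < fexp T")
      case True
      have "E (H T) (\<lambda>h. of_bool (n < Npulls h a \<and> Q (take n (rewards h a)))) \<le> E (H T) (\<lambda>_. 1)"
        by (intro E_mono finite_H) auto
      then show ?thesis using True q0 by (simp add: add_increasing2)
    next
      case False
      define F where "F xs = (\<Prod>i<length xs. g (xs ! i))" for xs
      have "E (H T) (\<lambda>h. of_bool (n < Npulls h a \<and> Q (take n (rewards h a))))
        \<le> E (H T) (\<lambda>h. of_bool (n \<le> Npulls h a) * F (take n (rewards h a)))"
      proof (intro E_mono finite_H)
        fix h
        have F0: "0 \<le> F (take n (rewards h a))" by (auto simp: F_def g_def intro!: prod_nonneg)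
        show "of_bool (n < Npulls h a \<and> Q (take n (rewards h a)))
          \<le> of_bool (n \<le> Npulls h a) * F (take n (rewards h a))"
        proof (cases "n < Npulls h a \<and> Q (take n (rewards h a))")
          case True
          define xs where "xs = take n (rewards h a)"
          have len: "length xs = n" using True by (simp add: xs_def Npulls_rewards)
          have "(\<Sum>x\<leftarrow>xs. \<tau> - ln (tilt m l x)) = real n * \<tau> - (\<Sum>x\<leftarrow>xs. ln (tilt m l x))"
            unfolding sum_list_subtractf by (simp add: len sum_list_triv)
          then have "0 \<le> s * (\<Sum>x\<leftarrow>xs. \<tau> - ln (tilt m l x))"
            using False True s by (simp add: Q_def xs_def)
          also have "\<dots> = (\<Sum>x\<leftarrow>xs. ln (g x))" by (simp add: g_def sum_list_const_mult)
          finally have "exp 0 \<le> exp (\<Sum>x\<leftarrow>xs. ln (g x))" by simp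
          also have "\<dots> = F xs" unfolding F_def by (rule exp_sum_list_ln) (simp add: g_def)
          finally show ?thesis using True by (simp add: xs_def)
        qed (use F0 in auto)
      qed
      also have "\<dots> \<le> E (replicate_pmf n (nu a)) F"
        by (rule E_take_rewards_le[OF a(1)]) (auto simp: F_def g_def intro!: prod_nonneg)
      also have "\<dots> = E (replicate_pmf n (nu a)) (\<lambda>xs. \<Prod>i<n. g (xs ! i))"
        by (intro E_cong) (auto simp: F_def set_replicate_pmf)
      also have "\<dots> = (\<Prod>i<n. E (nu a) g)"
        by (rule E_replicate_prod[OF fin])
      also have "\<dots> \<le> q ^ n"
      proof -
        have "E (nu a) g \<le> q" using mgf by (simp add: g_def[abs_def])
        moreover have "0 \<le> E (nu a) g" by (auto simp: g_def intro!: integral_nonneg_AE)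
        ultimately show ?thesis by (simp add: power_mono)
      qed
      finally show ?thesis using False by simp
    qed
    finally show "(\<Sum>t=K..<T. E (H t) (\<lambda>h. of_bool (pol h = a \<and> Npulls h a = n \<and> Q (rewards h a))))
      \<le> of_bool (real n * \<tau> < fexp T) + q ^ n" .
  qed
  also have "\<dots> = (\<Sum>n=1..T. of_bool (real n * \<tau> < fexp T)) + (\<Sum>n=1..T. q ^ n)"
    by (rule sum.distrib)
  also have "\<dots> \<le> fexp T / \<tau> + 1 / (1 - q)"
  proof (rule add_mono)
    have "(\<Sum>n=1..T. of_bool (real n * \<tau> < fexp T)) = real (card ({1..T} \<inter> {n. real n * \<tau> < fexp T}))"
      by (simp add: sum.If_cases of_bool_def)
    \<comment> \<open>Since the initial pull is accounted for elsewhere, \<open>n\<close> starts at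
      1 and the count is at most \<open>fexp T / \<tau>\<close> without rounding up.\<close>
    also have "card ({1..T} \<inter> {n. real n * \<tau> < fexp T}) \<le> card {1..nat \<lfloor>fexp T / \<tau>\<rfloor>}"
    proof (intro card_mono subsetI)
      fix n assume "n \<in> {1..T} \<inter> {n. real n * \<tau> < fexp T}"
      then have n: "1 \<le> n" "real n * \<tau> < fexp T" by auto
      then have "real n \<le> fexp T / \<tau>" using \<tau> by (simp add: pos_le_divide_eq)
      then show "n \<in> {1..nat \<lfloor>fexp T / \<tau>\<rfloor>}" using n(1) by (simp add: le_nat_floor)
    qed simp
    also have "real (card {1..nat \<lfloor>fexp T / \<tau>\<rfloor>}) \<le> fexp T / \<tau>"
      using f0 \<tau> by (simp add: of_nat_floor)
    finally show "(\<Sum>n=1..T. of_bool (real n * \<tau> < fexp T)) \<le> fexp T / \<tau>" by simp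
    have "(\<lambda>n. q ^ n) sums (1 / (1 - q))" using q q0 by (intro geometric_sums) auto
    then show "(\<Sum>n=1..T. q ^ n) \<le> 1 / (1 - q)"
      using q0 sum_le_suminf[of "\<lambda>n. q ^ n" "{1..T}"] by (simp add: sums_iff)
  qed
  finally show ?thesis .
qed

lemma E_Npulls_le:
  assumes kl: "klucb_policy K pol" and a: "a < K" "finsupp01 (nu a)"
    and b: "b < K" "finsupp01 (nu b)" "0 < mean (nu b)" "mean (nu b) < 1"
    and \<epsilon>: "0 < \<epsilon>" "\<epsilon> < 1" and m: "m = mean (nu b) * (1 - \<epsilon>)" and l: "0 \<le> l" "l \<le> 1"
    and pos: "\<And>x. x \<in> set_pmf (nu a) \<Longrightarrow> 0 < tilt m l x"
    and K: "2 \<le> K" and T: "3 \<le> T" and s: "0 \<le> s" and \<tau>: "0 < \<tau>"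
    and mgf: "E (nu a) (\<lambda>x. exp (s * (\<tau> - ln (tilt m l x)))) \<le> q" and q: "q < 1"
  shows "E (H T) (\<lambda>h. real (Npulls h a))
    \<le> 1 + 16 / (mean (nu b) * \<epsilon>) ^ 4 * (ln (ln (real T)) + 2) + (fexp T / \<tau> + 1 / (1 - q))"
proof -
  let ?P1 = "\<lambda>t. E (H t) (\<lambda>h. of_bool (ucb h b < m))"
  let ?P2 = "\<lambda>t. E (H t) (\<lambda>h. of_bool (pol h = a \<and> m \<le> ucb h a))"
  have m1: "m < 1"
  proof -
    have "0 < mean (nu b) * \<epsilon>" using b \<epsilon> by simp
    then show ?thesis using b by (simp add: m right_diff_distrib)
  qed
  have "E (H T) (\<lambda>h. real (Npulls h a)) = (\<Sum>t<T. E (H t) (\<lambda>h. of_bool (pol h = a)))"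
    by (rule E_Npulls)
  \<comment> \<open>Rounds are numbered from 0, so round \<open>t < K\<close> pulls arm
    \<open>t\<close>. From round \<open>K\<close> on, a pull of \<open>a\<close> with
    \<open>m <= ucb h b\<close> forces \<open>m <= ucb h a\<close> by maximality.\<close>
  also have "\<dots> \<le> (\<Sum>t<T. of_bool (t = a) + (if K \<le> t then ?P1 t + ?P2 t else 0))"
  proof (rule sum_mono)
    fix t
    show "E (H t) (\<lambda>h. of_bool (pol h = a)) \<le> of_bool (t = a) + (if K \<le> t then ?P1 t + ?P2 t else 0)"
    proof (cases "K \<le> t")
      case True
      have "E (H t) (\<lambda>h. of_bool (pol h = a))
        \<le> E (H t) (\<lambda>h. of_bool (ucb h b < m) + of_bool (pol h = a \<and> m \<le> ucb h a))"
      proof (intro E_mono finite_H)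
        fix h assume "h \<in> set_pmf (H t)"
        then have "ucb h b \<le> ucb h (pol h)"
          using kl True b(1) length_H[of h t] by (simp add: klucb_policy_def)
        then show "of_bool (pol h = a) \<le> (of_bool (ucb h b < m) + of_bool (pol h = a \<and> m \<le> ucb h a) :: real)"
          by auto
      qed
      then show ?thesis using True by (simp add: E_add finite_H add_increasing)
    next
      case False
      have "E (H t) (\<lambda>h. of_bool (pol h = a)) = E (H t) (\<lambda>h. of_bool (t = a))"
        using False pol_init length_H by (intro E_cong) auto
      then show ?thesis using False by simp
    qed
  qed
  also have "\<dots> = (\<Sum>t<T. of_bool (t = a)) + (\<Sum>t<T. if K \<le> t then ?P1 t + ?P2 t else 0)"
    by (rule sum.distrib)
  also have "(\<Sum>t<T. if K \<le> t then ?P1 t + ?P2 t else 0) = (\<Sum>t=K..<T. ?P1 t) + (\<Sum>t=K..<T. ?P2 t)"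
  proof -
    have "(\<Sum>t<T. if K \<le> t then ?P1 t + ?P2 t else 0) = (\<Sum>t=K..<T. ?P1 t + ?P2 t)"
      by (subst sum.inter_filter[symmetric]) (auto intro!: sum.cong)
    then show ?thesis by (simp only: sum.distrib)
  qed
  also have "(\<Sum>t<T. of_bool (t = a)) \<le> (1::real)"
    by (simp add: of_bool_def sum.delta)
  also have "(\<Sum>t=K..<T. ?P1 t) \<le> 16 / (mean (nu b) * \<epsilon>) ^ 4 * (ln (ln (real T)) + 2)"
  proof -
    have "(\<Sum>t=K..<T. ?P1 t) \<le> (\<Sum>t=K..<T. 16 / (mean (nu b) * \<epsilon>) ^ 4 * (1 / (real t * ln (real t))))"
      unfolding m using K by (intro sum_mono prob_ucb_less[OF b \<epsilon>]) auto
    also have "\<dots> \<le> (\<Sum>t=2..<T. 16 / (mean (nu b) * \<epsilon>) ^ 4 * (1 / (real t * ln (real t))))"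
      using K by (intro sum_mono2) auto
    also have "\<dots> = 16 / (mean (nu b) * \<epsilon>) ^ 4 * (\<Sum>t=2..<T. 1 / (real t * ln (real t)))"
      by (rule sum_distrib_left[symmetric])
    also have "\<dots> \<le> 16 / (mean (nu b) * \<epsilon>) ^ 4 * (ln (ln (real T)) + 2)"
      using sum_inverse_t_ln_t[OF T] by (intro mult_left_mono) auto
    finally show ?thesis .
  qed
  also have "(\<Sum>t=K..<T. ?P2 t) \<le> fexp T / \<tau> + 1 / (1 - q)"
    using T by (intro sum_prob_le_ucb[OF a m1 l pos K _ s \<tau> mgf q]) auto
  finally show ?thesis by simp
qed

end

section \<open>Stability in the threshold and deviations of the suboptimal arm\<close>

lemma tilt_mono:
  assumes "m \<le> m'" "m' < 1" "0 \<le> l" "x \<le> 1"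
  shows "tilt m l x \<le> tilt m' l x"
proof -
  have "(1 - x) / (1 - m) \<le> (1 - x) / (1 - m')" using assms by (intro divide_left_mono) auto
  then have "l * ((1 - x) / (1 - m)) \<le> l * ((1 - x) / (1 - m'))" using assms by (intro mult_left_mono)
  then show ?thesis by (simp add: tilt_def)
qed

text \<open>Multiplying \<open>tilt m l x\<close> by \<open>r = (1 - m) / (1 - m') >= 1\<close>
  reproduces the linear part of \<open>tilt m' l x\<close> and can only increase the constant
  \<open>1 - l\<close>; then \<open>ln r <= r - 1\<close>.\<close>

lemma ln_tilt_ge:
  assumes "m \<le> m'" "m' < 1" "0 \<le> l" "l \<le> 1" "0 < tilt m l x" "0 < tilt m' l x"
  shows "ln (tilt m' l x) - (m' - m) / (1 - m') \<le> ln (tilt m l x)"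
proof -
  define r where "r = (1 - m) / (1 - m')"
  have r: "1 \<le> r" "r = 1 + (m' - m) / (1 - m')" using assms by (auto simp: r_def field_simps)
  have "1 * (1 - l) \<le> r * (1 - l)" using r assms by (intro mult_right_mono) auto
  moreover have "l * ((1 - x) / (1 - m')) = r * (l * ((1 - x) / (1 - m)))"
    using assms by (simp add: r_def)
  ultimately have "tilt m' l x \<le> r * tilt m l x" by (simp add: tilt_def distrib_left)
  then have "ln (tilt m' l x) \<le> ln (r * tilt m l x)" using assms r by (subst ln_le_cancel_iff) auto
  also have "\<dots> = ln r + ln (tilt m l x)" using assms r(1) by (simp add: ln_mult)
  also have "ln r \<le> r - 1" using r(1) by (intro ln_le_minus_one) auto
  finally show ?thesis using r(2) by simp
qed

text \<open>Lowering the threshold costs at most \<open>c * \<epsilon>\<close> of the drift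
  \<open>\<kappa>\<close>. The level \<open>\<kappa> - 3/2 * c * \<epsilon>\<close> therefore leaves
  a margin \<open>d = c * \<epsilon> / 2\<close>, to which \<open>mgf_le\<close> is applied.\<close>

lemma chernoff_tilt:
  assumes p: "finsupp01 p" and \<mu>: "0 < \<mu>" "\<mu> < 1" and l: "0 \<le> l" "l \<le> 1"
    and pos: "\<And>x. x \<in> set_pmf p \<Longrightarrow> 0 < tilt \<mu> l x"
    and \<kappa>: "0 < \<kappa>" "\<kappa> \<le> (\<Sum>x\<in>set_pmf p. pmf p x * ln (tilt \<mu> l x))"
  defines "c \<equiv> \<mu> / (1 - \<mu>)"
  shows "\<exists>B>0. \<forall>\<epsilon>. 0 < \<epsilon> \<and> \<epsilon> < 1 \<and> 0 < \<kappa> - 3/2 * c * \<epsilon> \<longrightarrow>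
    (\<exists>s\<ge>0. E p (\<lambda>x. exp (s * (\<kappa> - 3/2 * c * \<epsilon> - ln (tilt (\<mu> * (1 - \<epsilon>)) l x))))
       \<le> 1 - (c * \<epsilon>)\<^sup>2 / (16 * B\<^sup>2))"
proof -
  have fin: "finite (set_pmf p)" and p01: "\<And>x. x \<in> set_pmf p \<Longrightarrow> 0 \<le> x \<and> x \<le> 1"
    using p by (auto simp: finsupp01_def)
  have c: "0 < c" using \<mu> by (simp add: c_def)
  \<comment> \<open>A bound uniform in \<open>\<epsilon>\<close>: the tilt at any \<open>m\<close>
    between 0 and \<open>\<mu>\<close> lies between the tilts at these endpoints.\<close>
  define B where "B = (\<Sum>x\<in>set_pmf p. \<bar>ln (tilt 0 l x)\<bar> + \<bar>ln (tilt \<mu> l x)\<bar>) + \<kappa> + c"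
  have B: "c \<le> B" using \<kappa> by (auto simp: B_def intro!: add_increasing sum_nonneg)
  then have B0: "0 < B" using c by simp
  have "\<exists>s\<ge>0. E p (\<lambda>x. exp (s * (\<kappa> - 3/2 * c * \<epsilon> - ln (tilt (\<mu> * (1 - \<epsilon>)) l x))))
       \<le> 1 - (c * \<epsilon>)\<^sup>2 / (16 * B\<^sup>2)"
    if \<epsilon>: "0 < \<epsilon>" "\<epsilon> < 1" and \<tau>: "0 < \<kappa> - 3/2 * c * \<epsilon>" for \<epsilon>
  proof -
    define m where "m = \<mu> * (1 - \<epsilon>)"
    define \<tau> where "\<tau> = \<kappa> - 3/2 * c * \<epsilon>"
    define Y where "Y x = ln (tilt m l x) - \<tau>" for x
    define d where "d = c * \<epsilon> / 2"
    define s where "s = d / (2 * B\<^sup>2)"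
    have m: "0 \<le> m" "m \<le> \<mu>" "m < 1"
    proof -
      show "m \<le> \<mu>" using mult_left_mono[of "1 - \<epsilon>" 1 \<mu>] \<mu> \<epsilon> by (simp add: m_def)
      then show "m < 1" using \<mu> by simp
    qed (use \<mu> \<epsilon> in \<open>simp add: m_def\<close>)
    have d: "0 < d" "d \<le> B"
    proof -
      have "c * \<epsilon> \<le> c" using mult_left_mono[of \<epsilon> 1 c] c \<epsilon> by simp
      then show "d \<le> B" using B c unfolding d_def by linarith
    qed (use c \<epsilon> in \<open>simp add: d_def\<close>)
    have tp: "0 < tilt m' l x" if "x \<in> set_pmf p" "m' < 1" for m' x
      using tilt_pos_mono[OF pos[OF that(1)] that(2) l] p01[OF that(1)] by simp
    have Y: "\<bar>Y x\<bar> \<le> B" if x: "x \<in> set_pmf p" for x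
    proof -
      have "ln (tilt 0 l x) \<le> ln (tilt m l x)" "ln (tilt m l x) \<le> ln (tilt \<mu> l x)"
        using tp[OF x] m \<mu> l p01[OF x] by (auto intro!: tilt_mono)
      then have "\<bar>ln (tilt m l x)\<bar> \<le> \<bar>ln (tilt 0 l x)\<bar> + \<bar>ln (tilt \<mu> l x)\<bar>" by linarith
      also have "\<dots> \<le> (\<Sum>x\<in>set_pmf p. \<bar>ln (tilt 0 l x)\<bar> + \<bar>ln (tilt \<mu> l x)\<bar>)"
        using x fin by (intro member_le_sum[where f = "\<lambda>x. \<bar>ln (tilt 0 l x)\<bar> + \<bar>ln (tilt \<mu> l x)\<bar>"]) auto
      finally have "\<bar>ln (tilt m l x)\<bar> \<le> B - \<kappa> - c" by (simp add: B_def)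
      moreover have "\<bar>\<tau>\<bar> \<le> \<kappa>" using \<tau> c \<epsilon> by (simp add: \<tau>_def)
      ultimately show ?thesis using c unfolding Y_def by linarith
    qed
    have "\<kappa> - c * \<epsilon> - \<tau> \<le> (\<Sum>x\<in>set_pmf p. pmf p x * ln (tilt \<mu> l x)) - c * \<epsilon> - \<tau>"
      using \<kappa> by simp
    also have "\<dots> = (\<Sum>x\<in>set_pmf p. pmf p x * (ln (tilt \<mu> l x) - c * \<epsilon> - \<tau>))"
      using sum_pmf_eq_1[OF fin order_refl]
      by (simp add: right_diff_distrib sum_subtractf sum_distrib_right[symmetric])
    also have "\<dots> \<le> (\<Sum>x\<in>set_pmf p. pmf p x * Y x)"
    proof (intro sum_mono mult_left_mono)
      fix x assume x: "x \<in> set_pmf p"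
      have "(\<mu> - m) / (1 - \<mu>) = c * \<epsilon>" by (simp add: m_def c_def algebra_simps)
      then show "ln (tilt \<mu> l x) - c * \<epsilon> - \<tau> \<le> Y x"
        using ln_tilt_ge[of m \<mu> l x] tp[OF x] m \<mu> l by (simp add: Y_def)
    qed simp
    also have "\<dots> = E p Y" using fin
      by (subst integral_measure_pmf_real[where A = "set_pmf p"]) (auto simp: mult.commute)
    finally have EY: "d \<le> E p Y" unfolding d_def \<tau>_def by linarith
    have s: "0 \<le> s" "s * B \<le> 1" using d B0 by (auto simp: s_def power2_eq_square divide_le_eq)
    have "E p (\<lambda>x. exp (- s * Y x)) \<le> 1 - s * d + s\<^sup>2 * B\<^sup>2"
      by (rule mgf_le[OF fin Y EY s])
    also have "\<dots> = 1 - d\<^sup>2 / (4 * B\<^sup>2)" using B0 by (simp add: s_def power2_eq_square field_simps)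
    also have "\<dots> = 1 - (c * \<epsilon>)\<^sup>2 / (16 * B\<^sup>2)" by (simp add: d_def power_divide)
    also have "(\<lambda>x. exp (- s * Y x)) = (\<lambda>x. exp (s * (\<tau> - ln (tilt m l x))))"
      by (simp add: Y_def algebra_simps)
    finally show ?thesis using s(1) by (auto simp: \<tau>_def m_def)
  qed
  then show ?thesis using B0 by blast
qed

lemma threshold_asymp:
  assumes "0 < \<kappa>" "0 < (c::real)"
  shows "eventually (\<lambda>L. 0 < \<kappa> - 3/2 * c * L powr (-1/5) \<and>
    (L + ln L) / (\<kappa> - 3/2 * c * L powr (-1/5)) \<le> (L + ln L) / \<kappa> + 2 * c / \<kappa>\<^sup>2 * L powr (4/5)) at_top"
proof -
  have "((\<lambda>L::real. L powr (-1/5)) \<longlongrightarrow> 0) at_top" by real_asymp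
  \<comment> \<open>This makes \<open>3/2 * c * u\<close> at most \<open>\<kappa> / 8\<close>.
    Together with \<open>ln L < L / 6\<close> the constants combine to
    \<open>(7/6) * (3/2) / (7/8) = 2\<close>, the coefficient in the claim.\<close>
  then have "eventually (\<lambda>L::real. L powr (-1/5) < \<kappa> / (12 * c)) at_top"
    using assms by (intro order_tendstoD) auto
  moreover have "eventually (\<lambda>L::real. ln L < L / 6) at_top" by real_asymp
  moreover have "eventually (\<lambda>L::real. 1 \<le> L) at_top" by (rule eventually_ge_at_top)
  ultimately show ?thesis
  proof eventually_elim
    case (elim L)
    define u where "u = L powr (-1/5)"
    define \<tau> where "\<tau> = \<kappa> - 3/2 * c * u"
    have u: "0 \<le> u" by (simp add: u_def)
    have \<tau>: "7/8 * \<kappa> \<le> \<tau>" using elim assms by (simp add: \<tau>_def u_def field_simps)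
    then have \<tau>0: "0 < \<tau>" using assms by linarith
    have Lu: "L powr (4/5) = L * u"
      using powr_mult_base[of L "-1/5"] elim by (simp add: u_def)
    have "(L + ln L) / \<tau> - (L + ln L) / \<kappa> = (L + ln L) * (3/2 * c * u) / (\<kappa> * \<tau>)"
      using \<tau>0 assms by (simp add: \<tau>_def field_simps)
    also have "\<dots> \<le> (7/6 * L) * (3/2 * c * u) / (\<kappa> * (7/8 * \<kappa>))"
      using elim assms u \<tau> \<tau>0 by (intro frac_le mult_right_mono mult_left_mono mult_nonneg_nonneg mult_pos_pos) auto
    also have "\<dots> = 2 * c / \<kappa>\<^sup>2 * (L * u)" using assms by (simp add: field_simps power2_eq_square)
    finally show ?case using \<tau>0 unfolding Lu by (simp add: \<tau>_def u_def)
  qed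
qed

theorem theorem2:
  fixes \<nu> :: "real pmf" and \<mu>s :: real
  assumes "finsupp01 \<nu>" and "0 < mean \<nu>" and "mean \<nu> < \<mu>s" and "\<mu>s < 1"
  shows "\<exists>M>0. \<forall>K (nu :: nat \<Rightarrow> real pmf) a pol (T :: nat).
     2 \<le> K \<and> a < K \<and> nu a = \<nu> \<and>
     (\<forall>b<K. finsupp01 (nu b) \<and> 0 < mean (nu b)) \<and>
     \<mu>s = Max ((\<lambda>b. mean (nu b)) ` {..<K}) \<and>
     klucb_policy K pol \<and> 3 \<le> T \<longrightarrow>
     measure_pmf.expectation (hist pol nu T) (\<lambda>h. real (Npulls h a))
       \<le> ln (real T) / real_of_ereal (Kinf \<nu> \<mu>s)
         + 36 / \<mu>s ^ 4 * ln (real T) powr (4/5) * ln (ln (real T))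
         + (72 / \<mu>s ^ 4 + 2 * \<mu>s / ((1 - \<mu>s) * real_of_ereal (Kinf \<nu> \<mu>s) ^ 2))
             * ln (real T) powr (4/5)
         + (1 - \<mu>s) ^ 2 * M / (2 * \<mu>s ^ 2) * ln (real T) powr (2/5)
         + ln (ln (real T)) / real_of_ereal (Kinf \<nu> \<mu>s)
         + 2 * \<mu>s / ((1 - \<mu>s) * real_of_ereal (Kinf \<nu> \<mu>s) ^ 2)
         + 4"
proof -
  obtain \<kappa> l where \<kappa>: "0 < \<kappa>" "Kinf \<nu> \<mu>s = ereal \<kappa>" and l: "0 \<le> l" "l \<le> 1"
    and pos: "\<And>x. x \<in> set_pmf \<nu> \<Longrightarrow> 0 < tilt \<mu>s l x"
    and \<kappa>_le: "\<kappa> \<le> (\<Sum>x\<in>set_pmf \<nu>. pmf \<nu> x * ln (tilt \<mu>s l x))"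
    using Kinf_dual[OF assms(1,3,4)] by blast
  have \<mu>s: "0 < \<mu>s" "\<mu>s < 1" using assms by auto
  define c where "c = \<mu>s / (1 - \<mu>s)"
  have c: "0 < c" using \<mu>s by (simp add: c_def)
  obtain B where B: "0 < B" and chernoff:
    "\<And>\<epsilon>. 0 < \<epsilon> \<Longrightarrow> \<epsilon> < 1 \<Longrightarrow> 0 < \<kappa> - 3/2 * c * \<epsilon> \<Longrightarrow>
      \<exists>s\<ge>0. E \<nu> (\<lambda>x. exp (s * (\<kappa> - 3/2 * c * \<epsilon> - ln (tilt (\<mu>s * (1 - \<epsilon>)) l x))))
        \<le> 1 - (c * \<epsilon>)\<^sup>2 / (16 * B\<^sup>2)"
    using chernoff_tilt[OF assms(1) \<mu>s l pos \<kappa>(1) \<kappa>_le] unfolding c_def by blast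
  have "eventually (\<lambda>T. 0 < \<kappa> - 3/2 * c * ln (real T) powr (-1/5) \<and>
    (ln (real T) + ln (ln (real T))) / (\<kappa> - 3/2 * c * ln (real T) powr (-1/5))
      \<le> (ln (real T) + ln (ln (real T))) / \<kappa> + 2 * c / \<kappa>\<^sup>2 * ln (real T) powr (4/5)) at_top"
  proof (rule eventually_compose_filterlim[OF threshold_asymp[OF \<kappa>(1) c]])
    show "filterlim (\<lambda>T. ln (real T)) at_top sequentially" by real_asymp
  qed
  then obtain T0 where T0: "\<And>T. T0 \<le> T \<Longrightarrow> 0 < \<kappa> - 3/2 * c * ln (real T) powr (-1/5) \<and>
    (ln (real T) + ln (ln (real T))) / (\<kappa> - 3/2 * c * ln (real T) powr (-1/5))
      \<le> (ln (real T) + ln (ln (real T))) / \<kappa> + 2 * c / \<kappa>\<^sup>2 * ln (real T) powr (4/5)"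
    unfolding eventually_sequentially by blast
  \<comment> \<open>\<open>T0\<close> and \<open>B\<close> are fixed before any bandit is
    introduced, so \<open>C\<close> depends only on \<open>\<nu>\<close> and \<open>\<mu>s\<close>.
    Its first summand covers all \<open>T < T0\<close>, its second the geometric sum.
    \<open>M\<close> is then chosen so that the coefficient in the claim equals
    \<open>C\<close>.\<close>
  define C where "C = real T0 + 16 * B\<^sup>2 / c\<^sup>2"
  have C: "0 < C" "real T0 \<le> C" "16 * B\<^sup>2 / c\<^sup>2 \<le> C" using B c by (auto simp: C_def intro: add_nonneg_pos)
  define M where "M = 2 * \<mu>s\<^sup>2 / (1 - \<mu>s)\<^sup>2 * C"
  have MC: "(1 - \<mu>s)\<^sup>2 * M / (2 * \<mu>s\<^sup>2) = C" using \<mu>s by (simp add: M_def)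
  have cc: "2 * \<mu>s / ((1 - \<mu>s) * \<kappa>\<^sup>2) = 2 * c / \<kappa>\<^sup>2" by (simp add: c_def)
  have main: "E (hist pol nu T) (\<lambda>h. real (Npulls h a))
     \<le> ln (real T) / \<kappa> + 36 / \<mu>s ^ 4 * ln (real T) powr (4/5) * ln (ln (real T))
         + (72 / \<mu>s ^ 4 + 2 * c / \<kappa>\<^sup>2) * ln (real T) powr (4/5)
         + C * ln (real T) powr (2/5) + ln (ln (real T)) / \<kappa> + 2 * c / \<kappa>\<^sup>2 + 4"
    if K: "2 \<le> K" and a: "a < K" "nu a = \<nu>" and nu: "\<forall>b<K. finsupp01 (nu b) \<and> 0 < mean (nu b)"
      and max: "\<mu>s = Max ((\<lambda>b. mean (nu b)) ` {..<K})" and kl: "klucb_policy K pol" and T: "3 \<le> T"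
    for K nu a pol T
  proof -
    interpret bandit K nu pol
    proof
      show "pol h < K" for h using kl by (cases "length h < K") (auto simp: klucb_policy_def)
    qed (use nu kl in \<open>auto simp: finsupp01_def klucb_policy_def\<close>)
    define L where "L = ln (real T)"
    have "ln 3 \<le> L" using T by (simp add: L_def)
    then have L: "1 < L" using ln3_gt_1 by linarith
    then have lnL: "0 < ln L" by simp
    have nonneg: "0 \<le> L / \<kappa>" "0 \<le> 36 / \<mu>s ^ 4 * L powr (4/5) * ln L"
      "0 \<le> (72 / \<mu>s ^ 4 + 2 * c / \<kappa>\<^sup>2) * L powr (4/5)" "0 \<le> ln L / \<kappa>" "0 \<le> 2 * c / \<kappa>\<^sup>2"
      using L lnL \<kappa>(1) \<mu>s c by auto
    have "E (H T) (\<lambda>h. real (Npulls h a))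
     \<le> L / \<kappa> + 36 / \<mu>s ^ 4 * L powr (4/5) * ln L + (72 / \<mu>s ^ 4 + 2 * c / \<kappa>\<^sup>2) * L powr (4/5)
         + C * L powr (2/5) + ln L / \<kappa> + 2 * c / \<kappa>\<^sup>2 + 4"
    proof (cases "T0 \<le> T")
      case False
      have "E (H T) (\<lambda>h. real (Npulls h a)) \<le> E (H T) (\<lambda>_. real T0)"
      proof (intro E_mono finite_H)
        fix h assume "h \<in> set_pmf (H T)"
        then show "real (Npulls h a) \<le> real T0"
          using False length_H[of h T] length_filter_le[of "\<lambda>p. fst p = a" h] by (simp add: Npulls_def)
      qed
      also have "\<dots> \<le> C * 1" using C by simp
      also have "\<dots> \<le> C * L powr (2/5)" using L C by (intro mult_left_mono ge_one_powr_ge_zero) auto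
      finally show ?thesis using nonneg by linarith
    next
      case True
      \<comment> \<open>With this rate \<open>1 / \<epsilon> ^ 4\<close> is
        \<open>L powr (4/5)\<close> and \<open>1 / \<epsilon>\<^sup>2\<close> is
        \<open>L powr (2/5)\<close>; \<open>\<epsilon> < 1\<close> holds because
        \<open>T >= 3\<close> gives \<open>L > 1\<close>.\<close>
      define \<epsilon> where "\<epsilon> = L powr (-1/5)"
      define \<tau> where "\<tau> = \<kappa> - 3/2 * c * \<epsilon>"
      have \<epsilon>: "0 < \<epsilon>" "\<epsilon> < 1" using L by (auto simp: \<epsilon>_def powr_less_one)
      have \<tau>: "0 < \<tau>" "(L + ln L) / \<tau> \<le> (L + ln L) / \<kappa> + 2 * c / \<kappa>\<^sup>2 * L powr (4/5)"
        using T0[OF True] by (simp_all add: \<tau>_def \<epsilon>_def L_def)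
      have "\<mu>s \<in> (\<lambda>b. mean (nu b)) ` {..<K}" unfolding max using K by (intro Max_in) (auto simp: lessThan_empty_iff)
      then obtain b where b: "b < K" "mean (nu b) = \<mu>s" by auto
      obtain s where s: "0 \<le> s" "E \<nu> (\<lambda>x. exp (s * (\<tau> - ln (tilt (\<mu>s * (1 - \<epsilon>)) l x))))
        \<le> 1 - (c * \<epsilon>)\<^sup>2 / (16 * B\<^sup>2)"
        using chernoff[OF \<epsilon>] \<tau>(1) unfolding \<tau>_def by blast
      have m1: "\<mu>s * (1 - \<epsilon>) < 1" using \<mu>s \<epsilon> mult_strict_mono[of \<mu>s 1 "1 - \<epsilon>" 1] by simp
      have pos': "0 < tilt (\<mu>s * (1 - \<epsilon>)) l x" if "x \<in> set_pmf \<nu>" for x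
        using tilt_pos_mono[OF pos[OF that] m1 l] that assms(1) by (auto simp: finsupp01_def)
      have "E (H T) (\<lambda>h. real (Npulls h a))
        \<le> 1 + 16 / (mean (nu b) * \<epsilon>) ^ 4 * (ln (ln (real T)) + 2)
          + (fexp T / \<tau> + 1 / (1 - (1 - (c * \<epsilon>)\<^sup>2 / (16 * B\<^sup>2))))"
        using nu assms(1) b a \<mu>s pos' s(2) c B \<epsilon>
        by (intro E_Npulls_le[OF kl a(1) _ b(1) _ _ _ \<epsilon> refl l _ K T s(1) \<tau>(1)]) auto
      also have "fexp T = L + ln L" by (simp add: fexp_def L_def)
      also have "1 / (1 - (1 - (c * \<epsilon>)\<^sup>2 / (16 * B\<^sup>2))) = 16 * B\<^sup>2 / c\<^sup>2 * L powr (2/5)"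
      proof -
        have "L powr (2/5) * \<epsilon>\<^sup>2 = 1"
          unfolding \<epsilon>_def power2_eq_square powr_add[symmetric] using L by simp
        then have eq: "L powr (2/5) = 1 / \<epsilon>\<^sup>2" using \<epsilon> by (simp add: field_simps)
        show ?thesis unfolding eq by (simp add: power_mult_distrib)
      qed
      also have "16 / (mean (nu b) * \<epsilon>) ^ 4 = 16 / \<mu>s ^ 4 * L powr (4/5)"
      proof -
        have "L powr (4/5) * \<epsilon> ^ 4 = 1"
          unfolding \<epsilon>_def power4_eq_xxxx powr_add[symmetric] using L by simp
        then have eq: "L powr (4/5) = 1 / \<epsilon> ^ 4" using \<epsilon> by (simp add: field_simps)
        show ?thesis unfolding eq by (simp add: b(2) power_mult_distrib)
      qed
      also have "ln (ln (real T)) = ln L" by (simp add: L_def)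
      finally have 1: "E (H T) (\<lambda>h. real (Npulls h a))
        \<le> 1 + 16 / \<mu>s ^ 4 * L powr (4/5) * (ln L + 2) + ((L + ln L) / \<tau> + 16 * B\<^sup>2 / c\<^sup>2 * L powr (2/5))" .
      have 2: "16 * B\<^sup>2 / c\<^sup>2 * L powr (2/5) \<le> C * L powr (2/5)"
        using C(3) by (intro mult_right_mono) auto
      \<comment> \<open>In units of \<open>P\<close> the optimal arm contributes
        \<open>16 * (P * ln L) + 32 * P\<close>, below the allowed 36 and 72; the remaining
        \<open>L powr (4/5)\<close> term pays for the lowered level \<open>\<tau>\<close>.\<close>
      define P where "P = L powr (4/5) / \<mu>s ^ 4"
      have P: "0 \<le> P" "0 \<le> P * ln L" using \<mu>s lnL by (auto simp: P_def)
      have 3: "16 / \<mu>s ^ 4 * L powr (4/5) * (ln L + 2) = 16 * (P * ln L) + 32 * P"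
        "36 / \<mu>s ^ 4 * L powr (4/5) * ln L = 36 * (P * ln L)"
        "(72 / \<mu>s ^ 4 + 2 * c / \<kappa>\<^sup>2) * L powr (4/5) = 72 * P + 2 * c / \<kappa>\<^sup>2 * L powr (4/5)"
        by (simp_all add: P_def algebra_simps add_divide_distrib)
      have 4: "(L + ln L) / \<kappa> = L / \<kappa> + ln L / \<kappa>" by (rule add_divide_distrib)
      show ?thesis using 1 2 \<tau>(2) P nonneg(5) unfolding 3 4 by linarith
    qed
    then show ?thesis by (simp add: L_def)
  qed
  show ?thesis
  proof (intro exI[of _ M] conjI)
    show "0 < M" using C(1) \<mu>s by (simp add: M_def)
  qed (unfold \<kappa>(2) real_of_ereal.simps MC cc, use main in blast)
qed

end
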